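(* Suppose functions $\varphi_j\in L_2$, $j\in\mathbb{N}$, satisfy the refinement equation $$\widehat{\varphi_j}(n)=\sqrt2\,\widehat{a_{j+1}}(n)\,\widehat{\varphi_{j+1}}(n),\quad n\in\mathbb{Z},\ j\in\mathbb{N},$$ for some $\widehat{a_{j+1}}\in\mathcal{S}(2^{j+1})$. For every $j\in\mathbb{Z}_+$ fix a positive integer $\rho_j$ and suppose $\psi^m_j\in L_2$, $m=1,\dots,\rho_j$, are defined by $$\widehat{\psi^m_j}(n)=\sqrt2\,\widehat{b^m_{j+1}}(n)\,\widehat{\varphi_{j+1}}(n),\quad n\in\mathbb{Z},$$ with some sequences $\widehat{b^m_{j+1}}\in\mathcal{S}(2^{j+1})$, $m=1,\dots,\rho_j$. Define $\theta_j\in\mathcal{S}(2^j)$ recursively by $$\theta_0(n)=0,\qquad \theta_1(n)=\sum_{m=1}^{\rho_0}\left|\widehat{b^m_1}(n)\right|^2,\qquad \theta_{j+1}(n)=\sum_{m=1}^{\rho_j}\left|\widehat{b^m_{j+1}}(n)\right|^2+\theta_j(n)\left|\widehat{a_{j+1}}(n)\right|^2\quad (j\in\mathbb{N}).$$ Then the collection $\{S^k_j\psi^m_j : j\in\mathbb{Z}_+,\ m=1,\dots,\rho_j,\ k\in\mathcal{R}_j\}$ forms a Parseval wavelet frame in $L_2$ if and only if the following two conditions hold: (i) $\displaystyle\lim_{j\to\infty}2^j|\widehat{\varphi_j}(n)|^2\theta_j(n)=1$ for all $n\in\mathbb{Z}$; (ii) for all $n\in\mathbb{Z}$, $j\in\mathbb{Z}_+$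 and all odd integers $k$, unless $\widehat{\varphi_{j+1}}(n)=0$ or $\widehat{\varphi_{j+1}}(2^jk+n)=0$, $$\theta_j(n)\,\overline{\widehat{a_{j+1}}(n)}\,\widehat{a_{j+1}}(n+2^j)+\sum_{m=1}^{\rho_j}\overline{\widehat{b^m_{j+1}}(n)}\,\widehat{b^m_{j+1}}(n+2^j)=0,$$ where for $j=0$ the first term is understood to be $0$ (since $\theta_0=0$).
   Context: $\mathbb{N}=\{1,2,\dots\}$, $\mathbb{Z}_+=\{0,1,2,\dots\}$. $L_2$ is the space of 1-periodic complex-valued square-integrable functions with $\langle f,g\rangle=\int_0^1 f(x)\overline{g(x)}\,dx$ and $\|f\|_2=\langle f,f\rangle^{1/2}$. Fourier coefficients are $\widehat f(n)=\langle f,e^{2\pi i n\cdot}\rangle$, $n\in\mathbb{Z}$. $\mathcal{S}(2^j)$ is the space of all $2^j$-periodic sequences of complex numbers indexed by $\mathbb{Z}$; $\widehat{a_j}$ and $\widehat{b^m_j}$ are simply names for such sequences. The shift operator is $S^k_jf=f(\cdot+2^{-j}k)$, and $\mathcal{R}_j=\{-2^{j-1}+1,-2^{j-1}+2,\dots,2^{j-1}\}$ for $j\ge1$, $\mathcal{R}_0=\{0\}$. The family $\{S^k_j\psi^m_j\}$ forms a Parseval wavelet frame in $L_2$ if $$\|f\|_2^2=\sum_{j=0}^{\infty}\sum_{m=1}^{\rho_j}\sum_{k\in\mathcal{R}_j}|\langle f,S^k_j\psi^m_j\rangle|^2\quad\text{for all } f\in L_2 .$$ *)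

theory Defs
  imports "HOL-Analysis.Analysis"
begin

text \<open>Elements of $L_2$ are represented by functions, not by classes modulo null sets;
  every quantity below is invariant under changes on null sets.\<close>

definition L2 :: "(real \<Rightarrow> complex) set" where
  "L2 = {f. f \<in> borel_measurable lebesgue \<and> (\<forall>x. f (x + 1) = f x) \<and>
            set_integrable lebesgue {0..1} (\<lambda>x. (cmod (f x))\<^sup>2)}"

definition L2_inner :: "(real \<Rightarrow> complex) \<Rightarrow> (real \<Rightarrow> complex) \<Rightarrow> complex" where
  "L2_inner f g = (LINT x:{0..1}|lebesgue. f x * cnj (g x))"

definition L2_norm :: "(real \<Rightarrow> complex) \<Rightarrow> real" where
  "L2_norm f = sqrt (Re (L2_inner f f))"

definition fourier_coeff :: "(real \<Rightarrow> complex) \<Rightarrow> int \<Rightarrow> complex" where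
  "fourier_coeff f n = L2_inner f (\<lambda>x. exp (2 * of_real pi * \<i> * of_int n * of_real x))"

definition periodic_seqs :: "nat \<Rightarrow> (int \<Rightarrow> complex) set" where
  "periodic_seqs N = {s. \<forall>n. s (n + int N) = s n}"

definition shift :: "nat \<Rightarrow> int \<Rightarrow> (real \<Rightarrow> complex) \<Rightarrow> real \<Rightarrow> complex" where
  "shift j k f = (\<lambda>x. f (x + real_of_int k / 2 ^ j))"

definition shift_range :: "nat \<Rightarrow> int set" where
  "shift_range j = (if j = 0 then {0} else {- (2 ^ (j - 1)) + 1 .. 2 ^ (j - 1)})"

text \<open>\<open>\<psi> j m\<close> is the function $\psi^m_j$; only the indices $1 \le m \le \rho_j$ matter.\<close>

definition parseval_wavelet_frame ::
    "(nat \<Rightarrow> nat) \<Rightarrow> (nat \<Rightarrow> nat \<Rightarrow> real \<Rightarrow> complex) \<Rightarrow> bool" where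
  "parseval_wavelet_frame \<rho> \<psi> \<longleftrightarrow>
     (\<forall>f\<in>L2. (\<lambda>j. \<Sum>m=1..\<rho> j. \<Sum>k\<in>shift_range j.
                  (cmod (L2_inner f (shift j k (\<psi> j m))))\<^sup>2) sums (L2_norm f)\<^sup>2)"

text \<open>\<open>a j\<close> is $\widehat{a_j}$ and \<open>b j m\<close> is $\widehat{b^m_j}$; \<open>b (Suc j)\<close> has $\rho_j$ members.
  The sequences $\widehat{a_j}$ start at $j = 2$; \<open>a 0\<close>, \<open>a 1\<close> and \<open>b 0\<close> do not enter.\<close>

fun theta :: "(nat \<Rightarrow> nat) \<Rightarrow> (nat \<Rightarrow> int \<Rightarrow> complex) \<Rightarrow> (nat \<Rightarrow> nat \<Rightarrow> int \<Rightarrow> complex)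
    \<Rightarrow> nat \<Rightarrow> int \<Rightarrow> complex" where
  "theta \<rho> a b 0 n = 0"
| "theta \<rho> a b (Suc 0) n = (\<Sum>m=1..\<rho> 0. of_real ((cmod (b 1 m n))\<^sup>2))"
| "theta \<rho> a b (Suc (Suc j)) n =
     (\<Sum>m=1..\<rho> (Suc j). of_real ((cmod (b (Suc (Suc j)) m n))\<^sup>2))
     + theta \<rho> a b (Suc j) n * of_real ((cmod (a (Suc (Suc j)) n))\<^sup>2)"

lemma periodic_seqs_mono:
  assumes "s \<in> periodic_seqs (2 ^ j)"
  shows "s \<in> periodic_seqs (2 ^ Suc j)"
proof -
  have p: "s (n + int (2 ^ j)) = s n" for n
    using assms by (simp add: periodic_seqs_def)
  have "s (n + int (2 ^ Suc j)) = s n" for n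
    using p[of "n + int (2 ^ j)"] p[of n] by (simp add: algebra_simps)
  then show ?thesis
    by (simp add: periodic_seqs_def)
qed

lemma theta_periodic:
  assumes "\<And>j. j \<ge> 1 \<Longrightarrow> a (j + 1) \<in> periodic_seqs (2 ^ (j + 1))"
    and "\<And>j m. m \<in> {1..\<rho> j} \<Longrightarrow> b (j + 1) m \<in> periodic_seqs (2 ^ (j + 1))"
  shows "theta \<rho> a b j \<in> periodic_seqs (2 ^ j)"
proof (induction j)
  case 0
  show ?case by (simp add: periodic_seqs_def)
next
  case (Suc j)
  have B: "b (Suc j) m (n + int (2 ^ Suc j)) = b (Suc j) m n" if "m \<in> {1..\<rho> j}" for m n
    using assms(2)[OF that] by (simp add: periodic_seqs_def)
  have T: "theta \<rho> a b j (n + int (2 ^ Suc j)) = theta \<rho> a b j n" for n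
    using periodic_seqs_mono[OF Suc.IH] by (simp add: periodic_seqs_def)
  have "theta \<rho> a b (Suc j) (n + int (2 ^ Suc j)) = theta \<rho> a b (Suc j) n" for n
  proof (cases j)
    case 0
    then show ?thesis using B by (auto intro!: sum.cong)
  next
    case (Suc i)
    have "a (Suc j) (n + int (2 ^ Suc j)) = a (Suc j) n"
      using assms(1)[of j] Suc by (simp add: periodic_seqs_def)
    then show ?thesis using B T[of n] Suc
      by (auto simp del: of_nat_power power_Suc intro!: sum.cong)
  qed
  then show ?case by (simp add: periodic_seqs_def)
qed

end

theory Submission imports Defs
begin

text \<open>Write $e_n(x) = e^{2\pi i n x}$ and
  $K_j(n,n') = \sum_{m,k} \langle e_n, S^k_j\psi^m_j\rangle \overline{\langle e_{n'}, S^k_j\psi^m_j\rangle}$.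
  By polarization, density of trigonometric polynomials and Cauchy--Schwarz, the frame is Parseval if
  and only if $\sum_j K_j(n,n') = \delta_{n,n'}$ for all $n, n'$. With
  $P_j(n,n') = 2^j \theta_j(n) \overline{\widehat{\varphi_j}(n)} \widehat{\varphi_j}(n')$ for
  $2^j \mid n' - n$ and $P_j(n,n') = 0$ otherwise, the refinement equation and the recursion for
  $\theta_j$ give $K_j + P_j = P_{j+1} + X_j$, where $X_j(n,n')$ is supported on
  $n' - n \in 2^j(2\mathbb{Z}+1)$ and is there
  $2^{j+1} \overline{\widehat{\varphi_{j+1}}(n)} \widehat{\varphi_{j+1}}(n')$ times the left-hand side
  of (ii). The sum over $j < J$ telescopes: on the diagonal it is $P_J(n,n)$, whence (i); off the
  diagonal exactly one $X_j$ can contribute, whence (ii).\<close>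

section \<open>The space of square-integrable periodic functions\<close>

abbreviation unit_measure :: "real measure" where
  "unit_measure \<equiv> lebesgue_on {0..1}"

lemma set_integrable_unit:
  fixes f :: "real \<Rightarrow> 'a::{banach, second_countable_topology}"
  shows "set_integrable lebesgue {0..1} f \<longleftrightarrow> integrable unit_measure f"
  by (simp add: set_integrable_def integrable_restrict_space)

lemma L2_inner_eq: "L2_inner f g = (LINT x|unit_measure. f x * cnj (g x))"
  by (simp add: L2_inner_def set_lebesgue_integral_def integral_restrict_space)

lemma L2_measurable: "f \<in> L2 \<Longrightarrow> f \<in> borel_measurable unit_measure"
  by (auto simp: L2_def intro: measurable_restrict_space1)

lemma L2_integrable: "f \<in> L2 \<Longrightarrow> integrable unit_measure (\<lambda>x. (cmod (f x))\<^sup>2)"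
  by (simp add: L2_def set_integrable_unit)

text \<open>A crude form of the arithmetic-geometric mean inequality; it dominates the product of
  two \<open>L2\<close> functions by an integrable function.\<close>

lemma norm_mult_le_squares:
  fixes a b :: "'a::real_normed_algebra"
  shows "norm (a * b) \<le> (norm a)\<^sup>2 + (norm b)\<^sup>2"
proof -
  have "norm (a * b) \<le> norm a * norm b" by (rule norm_mult_ineq)
  also have "\<dots> \<le> (norm a)\<^sup>2 + (norm b)\<^sup>2"
  proof -
    have "2 * (norm a * norm b) \<le> (norm a)\<^sup>2 + (norm b)\<^sup>2"
      using sum_squares_bound[of "norm a" "norm b"] by (simp add: mult.assoc)
    moreover have "0 \<le> norm a * norm b" by simp
    ultimately show ?thesis by linarith
  qed
  finally show ?thesis .
qed

lemma L2_mult_integrable: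
  assumes "f \<in> L2" "g \<in> L2"
  shows "integrable unit_measure (\<lambda>x. f x * cnj (g x))"
proof (rule Bochner_Integration.integrable_bound)
  show "integrable unit_measure (\<lambda>x. (cmod (f x))\<^sup>2 + (cmod (g x))\<^sup>2)"
    using assms by (auto intro: L2_integrable)
  show "(\<lambda>x. f x * cnj (g x)) \<in> borel_measurable unit_measure"
    using assms[THEN L2_measurable] by (intro borel_measurable_times) (auto simp: measurable_compose[OF _ borel_measurable_continuous_onI[of cnj]] continuous_on_cnj)
  show "AE x in unit_measure. norm (f x * cnj (g x)) \<le> norm ((cmod (f x))\<^sup>2 + (cmod (g x))\<^sup>2)"
    using norm_mult_le_squares[of "f _" "cnj (g _)"] by simp
qed

lemma L2_add:
  assumes "f \<in> L2" "g \<in> L2"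
  shows "(\<lambda>x. f x + g x) \<in> L2"
proof -
  have [measurable]: "f \<in> borel_measurable lebesgue" "g \<in> borel_measurable lebesgue"
    and per: "\<And>x. f (x + 1) = f x" "\<And>x. g (x + 1) = g x"
    using assms by (auto simp: L2_def)
  have [measurable]: "f \<in> borel_measurable unit_measure" "g \<in> borel_measurable unit_measure"
    using assms by (auto intro: L2_measurable)
  have "integrable unit_measure (\<lambda>x. (cmod (f x + g x))\<^sup>2)"
  proof (rule Bochner_Integration.integrable_bound)
    show "integrable unit_measure (\<lambda>x. 2 * (cmod (f x))\<^sup>2 + 2 * (cmod (g x))\<^sup>2)"
      by (intro Bochner_Integration.integrable_add integrable_mult_right L2_integrable assms)
    have "(cmod (f x + g x))\<^sup>2 \<le> 2 * (cmod (f x))\<^sup>2 + 2 * (cmod (g x))\<^sup>2" for x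
    proof -
      have "(cmod (f x + g x))\<^sup>2 \<le> (cmod (f x) + cmod (g x))\<^sup>2"
        by (intro power_mono norm_triangle_ineq) auto
      also have "\<dots> \<le> 2 * (cmod (f x))\<^sup>2 + 2 * (cmod (g x))\<^sup>2"
        using sum_squares_bound[of "cmod (f x)" "cmod (g x)"] by (simp add: power2_sum)
      finally show ?thesis .
    qed
    then show "AE x in unit_measure. norm ((cmod (f x + g x))\<^sup>2)
        \<le> norm (2 * (cmod (f x))\<^sup>2 + 2 * (cmod (g x))\<^sup>2)"
      by simp
  qed simp
  then show ?thesis
    using per by (auto simp: L2_def set_integrable_unit)
qed

lemma L2_cmult:
  assumes "f \<in> L2"
  shows "(\<lambda>x. c * f x) \<in> L2"
  using assms L2_integrable[OF assms]
  by (auto simp: L2_def norm_mult power_mult_distrib set_integrable_unit)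

lemma L2_zero: "(\<lambda>x. 0) \<in> L2"
  by (auto simp: L2_def set_integrable_unit)

lemma L2_diff:
  assumes "f \<in> L2" "g \<in> L2"
  shows "(\<lambda>x. f x - g x) \<in> L2"
  using L2_add[OF assms(1) L2_cmult[OF assms(2), of "-1"]] by simp

lemma L2_sum:
  assumes "\<And>i. i \<in> A \<Longrightarrow> f i \<in> L2"
  shows "(\<lambda>x. \<Sum>i\<in>A. f i x) \<in> L2"
  using assms
proof (induction A rule: infinite_finite_induct)
  case (insert i A)
  then show ?case using L2_add[of "f i" "\<lambda>x. \<Sum>i\<in>A. f i x"] by simp
qed (auto intro: L2_zero)

section \<open>Inner product, norm and their inequalities\<close>

lemma L2_inner_add_left:
  assumes "f \<in> L2" "g \<in> L2" "h \<in> L2"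
  shows "L2_inner (\<lambda>x. f x + g x) h = L2_inner f h + L2_inner g h"
  unfolding L2_inner_eq
  by (subst Bochner_Integration.integral_add[symmetric])
     (use assms in \<open>auto simp: algebra_simps intro: L2_mult_integrable\<close>)

lemma L2_inner_cmult_left: "L2_inner (\<lambda>x. c * f x) g = c * L2_inner f g"
  by (simp add: L2_inner_eq mult.assoc)

lemma L2_inner_diff_left:
  assumes "f \<in> L2" "g \<in> L2" "h \<in> L2"
  shows "L2_inner (\<lambda>x. f x - g x) h = L2_inner f h - L2_inner g h"
  using L2_inner_add_left[OF assms(1) L2_cmult[OF assms(2), of "-1"] assms(3)]
  by (simp add: L2_inner_cmult_left[of "-1", simplified])

lemma L2_inner_cnj: "cnj (L2_inner f g) = L2_inner g f"
  unfolding L2_inner_eq by (subst Bochner_Integration.integral_cnj[symmetric]) (simp add: mult.commute)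

lemma L2_inner_sum_left:
  assumes "\<And>i. i \<in> A \<Longrightarrow> f i \<in> L2" "h \<in> L2"
  shows "L2_inner (\<lambda>x. \<Sum>i\<in>A. f i x) h = (\<Sum>i\<in>A. L2_inner (f i) h)"
  using assms
proof (induction A rule: infinite_finite_induct)
  case (insert i A)
  then show ?case using L2_inner_add_left[of "f i" "\<lambda>x. \<Sum>i\<in>A. f i x" h] L2_sum[of A f] by simp
qed (auto simp: L2_inner_eq)

lemma L2_norm_square: "(L2_norm f)\<^sup>2 = (LINT x|unit_measure. (cmod (f x))\<^sup>2)"
proof -
  have "L2_inner f f = of_real (LINT x|unit_measure. (cmod (f x))\<^sup>2)"
    by (simp add: L2_inner_eq complex_norm_square[symmetric] del: of_real_power)
  moreover have "(LINT x|unit_measure. (cmod (f x))\<^sup>2) \<ge> 0"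
    by (rule Bochner_Integration.integral_nonneg) auto
  ultimately show ?thesis by (simp add: L2_norm_def)
qed

lemma L2_inner_self: "L2_inner f f = of_real ((L2_norm f)\<^sup>2)"
  by (simp add: L2_inner_eq L2_norm_square complex_norm_square[symmetric] del: of_real_power)

lemma L2_norm_nonneg: "L2_norm f \<ge> 0"
proof -
  have "(L2_norm f)\<^sup>2 = Re (L2_inner f f)"
    by (simp add: L2_inner_self del: of_real_power)
  then have "Re (L2_inner f f) \<ge> 0" by (metis zero_le_power2)
  then show ?thesis by (simp add: L2_norm_def)
qed

text \<open>For A > 0 evaluate the quadratic at its vertex t = C / A. For A = 0 it is affine in t
  and can stay nonnegative only if C = 0.\<close>

lemma nonneg_quadratic_imp_discriminant:
  fixes A B C :: real
  assumes "\<And>t. t\<^sup>2 * A - 2 * t * C + B \<ge> 0" "A \<ge> 0"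
  shows "C\<^sup>2 \<le> A * B"
proof (cases "A = 0")
  case True
  have "C = 0"
  proof (rule ccontr)
    assume "C \<noteq> 0"
    \<comment> \<open>At this t the affine expression takes the value -1.\<close>
    with assms(1)[of "(B + 1) / (2 * C)"] True show False by (simp add: field_simps)
  qed
  with True show ?thesis by simp
next
  case False
  with assms(2) have "A > 0" by simp
  with assms(1)[of "C / A"] show ?thesis by (simp add: field_simps power2_eq_square)
qed

text \<open>The integral of (t |f| - |g|)^2 is a nonnegative real quadratic in t. Working with the
  moduli keeps everything real, and the modulus of the inner product is at most the integral
  \<open>C\<close> of |f| |g|.\<close>

lemma L2_Cauchy_Schwarz:
  assumes "f \<in> L2" "g \<in> L2"
  shows "cmod (L2_inner f g) \<le> L2_norm f * L2_norm g"
proof -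
  define C where "C = (LINT x|unit_measure. cmod (f x) * cmod (g x))"
  have i: "integrable unit_measure (\<lambda>x. cmod (f x) * cmod (g x))"
    using integrable_norm[OF L2_mult_integrable[OF assms]] by (simp add: norm_mult)
  note ii = L2_integrable[OF assms(1)] L2_integrable[OF assms(2)]
  have le: "cmod (L2_inner f g) \<le> C"
    unfolding L2_inner_eq C_def
    using integral_norm_bound[of unit_measure "\<lambda>x. f x * cnj (g x)"] by (simp add: norm_mult)
  have "C\<^sup>2 \<le> (L2_norm f)\<^sup>2 * (L2_norm g)\<^sup>2"
  proof (rule nonneg_quadratic_imp_discriminant)
    fix t :: real
    have "0 \<le> (LINT x|unit_measure. (t * cmod (f x) - cmod (g x))\<^sup>2)"
      by (rule Bochner_Integration.integral_nonneg) auto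
    also have "\<dots> = (LINT x|unit_measure. t\<^sup>2 * (cmod (f x))\<^sup>2
        - 2 * t * (cmod (f x) * cmod (g x)) + (cmod (g x))\<^sup>2)"
      by (simp add: power2_diff power_mult_distrib algebra_simps)
    also have "\<dots> = t\<^sup>2 * (L2_norm f)\<^sup>2 - 2 * t * C + (L2_norm g)\<^sup>2"
      unfolding L2_norm_square C_def using i ii by simp
    finally show "t\<^sup>2 * (L2_norm f)\<^sup>2 - 2 * t * C + (L2_norm g)\<^sup>2 \<ge> 0" .
  qed simp
  then have "C \<le> L2_norm f * L2_norm g"
    by (intro power2_le_imp_le[of C "L2_norm f * L2_norm g"] mult_nonneg_nonneg L2_norm_nonneg)
      (simp only: power_mult_distrib)
  with le show ?thesis by simp
qed

lemma L2_norm_triangle: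
  assumes "f \<in> L2" "g \<in> L2"
  shows "L2_norm (\<lambda>x. f x + g x) \<le> L2_norm f + L2_norm g"
proof (rule power2_le_imp_le)
  let ?h = "\<lambda>x. f x + g x"
  have h: "?h \<in> L2" using assms by (rule L2_add)
  have "L2_inner ?h ?h = L2_inner f ?h + L2_inner g ?h"
    using assms h by (intro L2_inner_add_left)
  \<comment> \<open>Additivity has been proved in the first slot only; the second slot is reached
    through conjugate symmetry.\<close>
  moreover have "L2_inner f ?h = cnj (L2_inner f f + L2_inner g f)"
      "L2_inner g ?h = cnj (L2_inner f g + L2_inner g g)"
    using assms by (simp_all flip: L2_inner_add_left add: L2_inner_cnj)
  ultimately have "Re (L2_inner ?h ?h) = (L2_norm f)\<^sup>2 + 2 * Re (L2_inner f g) + (L2_norm g)\<^sup>2"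
    using L2_inner_cnj[of f g] by (simp add: L2_inner_self complex_eq_iff del: of_real_power)
  moreover have "Re (L2_inner f g) \<le> L2_norm f * L2_norm g"
    using L2_Cauchy_Schwarz[OF assms] complex_Re_le_cmod[of "L2_inner f g"] by linarith
  ultimately show "(L2_norm ?h)\<^sup>2 \<le> (L2_norm f + L2_norm g)\<^sup>2"
    by (simp add: L2_inner_self power2_sum del: of_real_power)
qed (simp add: L2_norm_nonneg)

lemma L2_norm_uminus: "L2_norm (\<lambda>x. - f x) = L2_norm f"
  by (simp add: L2_norm_def L2_inner_eq)

lemma L2_norm_minus_commute: "L2_norm (\<lambda>x. f x - g x) = L2_norm (\<lambda>x. g x - f x)"
  using L2_norm_uminus[of "\<lambda>x. f x - g x"] by simp

lemma L2_norm_triangle_diff: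
  assumes "f \<in> L2" "g \<in> L2"
  shows "L2_norm f \<le> L2_norm g + L2_norm (\<lambda>x. f x - g x)"
  using L2_norm_triangle[OF assms(2) L2_diff[OF assms]] by simp

section \<open>Translation invariance of integrals over one period\<close>

lemma periodic_int:
  assumes "\<And>x::real. f (x + 1) = f x"
  shows "f (x + of_int n) = f x"
proof (induction n rule: int_induct[where k = 0])
  case (step1 i)
  then show ?case using assms[of "x + of_int i"] by (simp add: algebra_simps)
next
  case (step2 i)
  then show ?case using assms[of "x + of_int (i - 1)"] by (simp add: algebra_simps)
qed simp

lemma borel_measurable_lebesgue_shift:
  fixes f :: "real \<Rightarrow> 'a::{banach, second_countable_topology}"
  assumes "f \<in> borel_measurable lebesgue"
  shows "(\<lambda>x. f (x + c)) \<in> borel_measurable lebesgue"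
proof -
  have "(\<lambda>x::real. c + 1 * x) \<in> lebesgue \<rightarrow>\<^sub>M lebesgue"
    using lebesgue_affine_measurable[where c="\<lambda>_. 1::real" and t=c] by simp
  from measurable_compose[OF this assms] show ?thesis by (simp add: add.commute)
qed

lemma set_integral_shift:
  fixes f :: "real \<Rightarrow> 'a::euclidean_space"
  assumes "set_integrable lebesgue {a + c..b + c} f"
  shows "set_integrable lebesgue {a..b} (\<lambda>x. f (x + c))"
    and "(LINT x:{a..b}|lebesgue. f (x + c)) = (LINT x:{a + c..b + c}|lebesgue. f x)"
proof -
  have eq: "(\<lambda>x. indicat_real {a + c..b + c} (c + 1 * x) *\<^sub>R f (c + 1 * x))
      = (\<lambda>x. indicat_real {a..b} x *\<^sub>R f (x + c))"
    by (auto simp: indicator_def add.commute)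
  have "has_bochner_integral lebesgue (\<lambda>x. indicator {a + c..b + c} x *\<^sub>R f x)
      (LINT x:{a + c..b + c}|lebesgue. f x)"
    using assms by (simp add: set_integrable_def set_lebesgue_integral_def has_bochner_integral_integrable)
  then have "has_bochner_integral lebesgue (\<lambda>x. indicator {a..b} x *\<^sub>R f (x + c))
      (LINT x:{a + c..b + c}|lebesgue. f x)"
    by (subst (asm) has_bochner_integral_lebesgue_real_affine_iff[where c = 1 and t = c])
      (simp_all only: eq, simp_all)
  then show "set_integrable lebesgue {a..b} (\<lambda>x. f (x + c))"
    and "(LINT x:{a..b}|lebesgue. f (x + c)) = (LINT x:{a + c..b + c}|lebesgue. f x)"
    by (auto simp: set_integrable_def set_lebesgue_integral_def has_bochner_integral_iff)
qed

text \<open>The two closed intervals share only the point b, a null set, so additivity over almost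
  disjoint sets applies.\<close>

lemma set_integral_atLeastAtMost_split:
  fixes f :: "real \<Rightarrow> 'a::euclidean_space"
  assumes "set_integrable lebesgue {a..b} f" "set_integrable lebesgue {b..c} f" "a \<le> b" "b \<le> c"
  shows "set_integrable lebesgue {a..c} f"
    and "(LINT x:{a..c}|lebesgue. f x) = (LINT x:{a..b}|lebesgue. f x) + (LINT x:{b..c}|lebesgue. f x)"
proof -
  have eq: "{a..c} = {a..b} \<union> {b..c}" using assms by auto
  show "set_integrable lebesgue {a..c} f"
    unfolding eq using assms by (intro set_integrable_Un) auto
  have "AE x in lebesgue. \<not> (x \<in> {a..b} \<and> x \<in> {b..c})"
    by (rule AE_I'[of "{b}"]) (auto simp: negligible_iff_null_sets[symmetric])
  then show "(LINT x:{a..c}|lebesgue. f x) = (LINT x:{a..b}|lebesgue. f x) + (LINT x:{b..c}|lebesgue. f x)"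
    unfolding eq using assms by (intro set_integral_Un_AE) auto
qed

text \<open>By periodicity only the fractional part d of c matters. The window [d, 1 + d] consists
  of [d, 1] and [1, 1 + d], and the latter is [0, d] moved by one period, so both windows give the
  same integral.\<close>

lemma integral_unit_shift:
  fixes f :: "real \<Rightarrow> 'a::euclidean_space"
  assumes int: "integrable unit_measure f" and per: "\<And>x. f (x + 1) = f x"
  shows "integrable unit_measure (\<lambda>x. f (x + c))"
    and "(LINT x|unit_measure. f (x + c)) = (LINT x|unit_measure. f x)"
proof -
  define d where "d = frac c"
  have d: "0 \<le> d" "d \<le> 1" by (auto simp: d_def frac_ge_0 frac_lt_1 less_imp_le)
  have sh: "f (x + c) = f (x + d)" for x
    using periodic_int[of f "x + d" "\<lfloor>c\<rfloor>", OF per] by (simp add: d_def frac_def algebra_simps)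
  have I: "set_integrable lebesgue {0..1} f" using int by (simp add: set_integrable_unit)
  have I1: "set_integrable lebesgue {0..d} f" and I2: "set_integrable lebesgue {d..1} f"
    using I by (rule set_integrable_subset; use d in auto)+
  have I3: "set_integrable lebesgue {1..1 + d} f"
      "(LINT x:{1..1 + d}|lebesgue. f x) = (LINT x:{0..d}|lebesgue. f x)"
    using set_integral_shift[of 1 "-1" "1 + d" f] I1 per[of "_ - 1"] by simp_all
  have I4: "set_integrable lebesgue {d..1 + d} f"
      "(LINT x:{d..1 + d}|lebesgue. f x) = (LINT x:{0..1}|lebesgue. f x)"
    using set_integral_atLeastAtMost_split[OF I2 I3(1)] set_integral_atLeastAtMost_split[OF I1 I2] I3(2) d
    by simp_all
  have "set_integrable lebesgue {0..1} (\<lambda>x. f (x + c))"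
      "(LINT x:{0..1}|lebesgue. f (x + c)) = (LINT x:{0..1}|lebesgue. f x)"
    using set_integral_shift[of 0 d 1 f] I4 by (simp_all add: sh)
  then show "integrable unit_measure (\<lambda>x. f (x + c))"
    and "(LINT x|unit_measure. f (x + c)) = (LINT x|unit_measure. f x)"
    by (simp_all add: set_integrable_unit set_lebesgue_integral_def integral_restrict_space)
qed

lemma L2_shift:
  assumes "f \<in> L2"
  shows "shift j k f \<in> L2"
proof -
  have "\<And>x. f (x + real_of_int k / 2 ^ j + 1) = f (x + real_of_int k / 2 ^ j)"
    using assms by (simp add: L2_def)
  moreover have "integrable unit_measure (\<lambda>x. (cmod (f (x + real_of_int k / 2 ^ j)))\<^sup>2)"
    using assms by (intro integral_unit_shift(1) L2_integrable) (auto simp: L2_def)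
  ultimately show ?thesis
    using assms borel_measurable_lebesgue_shift[of f]
    by (simp add: L2_def shift_def set_integrable_unit add.assoc add.commute[of _ 1] add.left_commute[of _ 1])
qed

section \<open>The orthonormal system of exponentials\<close>

definition expo :: "int \<Rightarrow> real \<Rightarrow> complex" where
  "expo n = (\<lambda>x. exp (2 * of_real pi * \<i> * of_int n * of_real x))"

lemma fourier_coeff_expo: "fourier_coeff f n = L2_inner f (expo n)"
  by (simp add: fourier_coeff_def expo_def)

lemma expo_add: "expo n (x + y) = expo n x * expo n y"
  by (simp add: expo_def ring_distribs exp_add)

lemma expo_add_index: "expo (m + n) x = expo m x * expo n x"
  by (simp add: expo_def ring_distribs exp_add)

lemma cnj_expo: "cnj (expo n x) = expo (- n) x"
  by (simp add: expo_def exp_cnj)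

lemma norm_expo [simp]: "norm (expo n x) = 1"
  by (simp add: expo_def)

lemma expo_mult_cnj: "expo n x * cnj (expo m x) = expo (n - m) x"
  using expo_add_index[of n "- m" x] by (simp add: cnj_expo)

lemma expo_0 [simp]: "expo 0 x = 1" "expo n 0 = 1"
  by (simp_all add: expo_def)

lemma expo_of_int: "expo n (of_int k) = 1"
proof -
  have "\<exists>m::int. 2 * pi * real_of_int n * real_of_int k = real_of_int (2 * m) * pi"
    by (rule exI[of _ "n * k"]) simp
  then show ?thesis by (simp add: expo_def exp_eq_1)
qed

lemma expo_periodic: "expo n (x + 1) = expo n x"
  using expo_of_int[of n 1] by (simp add: expo_add)

lemma continuous_on_expo: "continuous_on A (expo n)"
  unfolding expo_def by (intro continuous_intros)

lemma L2_expo: "expo n \<in> L2"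
proof -
  have "expo n \<in> borel_measurable lebesgue"
    using continuous_imp_measurable_on_sets_lebesgue[OF continuous_on_expo[of UNIV n]] by simp
  then show ?thesis
    by (auto simp: L2_def expo_periodic set_integrable_unit)
qed

lemma L2_inner_expo: "L2_inner (expo n) (expo m) = (if n = m then 1 else 0)"
proof -
  have "L2_inner (expo n) (expo m) = (LINT x:{0..1}|lebesgue. expo (n - m) x)"
    by (simp add: L2_inner_def expo_mult_cnj)
  also have "\<dots> = integral {0..1} (expo (n - m))"
    by (intro set_lebesgue_integral_eq_integral absolutely_integrable_continuous_real continuous_on_expo)
  also have "\<dots> = (if n = m then 1 else 0)"
  proof (cases "n = m")
    case False
    define w where "w = 2 * of_real pi * \<i> * of_int (n - m)"
    have w: "w \<noteq> 0" using False by (simp add: w_def)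
    have "(expo (n - m) has_integral (expo (n - m) 1 / w - expo (n - m) 0 / w)) {0..1}"
    proof (rule fundamental_theorem_of_calculus)
      fix x :: real
      have "((\<lambda>z. exp (w * z) / w) has_field_derivative exp (w * of_real x)) (at (of_real x))"
        using w by (auto intro!: derivative_eq_intros)
      from has_vector_derivative_real_field[OF this]
      show "((\<lambda>x. expo (n - m) x / w) has_vector_derivative expo (n - m) x) (at x within {0..1})"
        by (simp add: expo_def w_def)
    qed simp
    moreover have "expo (n - m) 1 = 1" using expo_of_int[of "n - m" 1] by simp
    ultimately show ?thesis using False by (simp add: integral_unique)
  next
    case True
    have "expo 0 = (\<lambda>x. 1)" by auto
    with True show ?thesis by simp
  qed
  finally show ?thesis .
qed

text \<open>The substitution x -> x + k / 2^j moves the shift from f to the exponential, where it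
  becomes a constant phase; \<open>integral_unit_shift\<close> then removes the translation of the
  integrand.\<close>

lemma L2_inner_expo_shift:
  assumes "f \<in> L2"
  shows "L2_inner (expo n) (shift j k f)
    = cnj (expo n (of_int k / 2 ^ j)) * cnj (fourier_coeff f n)"
proof -
  let ?c = "of_int k / 2 ^ j :: real"
  have one: "cnj (expo n ?c) * expo n ?c = 1"
    using expo_mult_cnj[of n ?c n] by (simp add: mult.commute)
  have "expo n x = cnj (expo n ?c) * expo n (x + ?c)" for x
    by (simp add: expo_add mult.left_commute[of "cnj _"] one)
  then have "L2_inner (expo n) (shift j k f)
      = (LINT x|unit_measure. cnj (expo n ?c) * (expo n (x + ?c) * cnj (f (x + ?c))))"
    unfolding L2_inner_eq shift_def by (metis (no_types, lifting) mult.assoc)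
  also have "\<dots> = cnj (expo n ?c) * (LINT x|unit_measure. expo n (x + ?c) * cnj (f (x + ?c)))"
    by simp
  also have "(LINT x|unit_measure. expo n (x + ?c) * cnj (f (x + ?c))) = L2_inner (expo n) f"
    unfolding L2_inner_eq using assms
    by (intro integral_unit_shift(2) L2_mult_integrable L2_expo) (auto simp: L2_def expo_periodic)
  also have "\<dots> = cnj (fourier_coeff f n)"
    by (simp add: fourier_coeff_expo L2_inner_cnj)
  finally show ?thesis .
qed

section \<open>Density of trigonometric polynomials\<close>

definition trig_polys :: "(real \<Rightarrow> complex) set" where
  "trig_polys = {\<lambda>x. \<Sum>n\<in>F. c n * expo n x | F c. finite F}"

lemma trig_polysI: "finite F \<Longrightarrow> (\<lambda>x. \<Sum>n\<in>F. c n * expo n x) \<in> trig_polys"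
  by (auto simp: trig_polys_def)

lemma trig_polysE:
  assumes "p \<in> trig_polys"
  obtains F c where "finite F" "p = (\<lambda>x. \<Sum>n\<in>F. c n * expo n x)"
  using assms by (auto simp: trig_polys_def)

lemma trig_polys_expo: "expo n \<in> trig_polys"
  using trig_polysI[of "{n}" "\<lambda>_. 1"] by simp

lemma trig_polys_zero: "(\<lambda>x. 0) \<in> trig_polys"
  using trig_polysI[of "{}"] by simp

lemma trig_polys_add:
  assumes "p \<in> trig_polys" "q \<in> trig_polys"
  shows "(\<lambda>x. p x + q x) \<in> trig_polys"
proof -
  obtain F c where F: "finite F" "p = (\<lambda>x. \<Sum>n\<in>F. c n * expo n x)"
    using assms(1) by (rule trig_polysE)
  obtain G d where G: "finite G" "q = (\<lambda>x. \<Sum>n\<in>G. d n * expo n x)"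
    using assms(2) by (rule trig_polysE)
  \<comment> \<open>Both coefficient functions are extended by zero to the union of the frequency
    sets.\<close>
  define s where "s n = (if n \<in> F then c n else 0) + (if n \<in> G then d n else 0)" for n
  have "p x + q x = (\<Sum>n\<in>F \<union> G. s n * expo n x)" for x
  proof -
    have "p x = (\<Sum>n\<in>F \<union> G. (if n \<in> F then c n else 0) * expo n x)"
      unfolding F(2) using F(1) G(1) by (intro sum.mono_neutral_cong_left) auto
    moreover have "q x = (\<Sum>n\<in>F \<union> G. (if n \<in> G then d n else 0) * expo n x)"
      unfolding G(2) using F(1) G(1) by (intro sum.mono_neutral_cong_left) auto
    ultimately show ?thesis
      by (simp only: s_def ring_distribs sum.distrib)
  qed
  then show ?thesis using trig_polysI[of "F \<union> G" s] F(1) G(1) by simp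
qed

lemma trig_polys_sum:
  assumes "\<And>i. i \<in> A \<Longrightarrow> p i \<in> trig_polys"
  shows "(\<lambda>x. \<Sum>i\<in>A. p i x) \<in> trig_polys"
  using assms
proof (induction A rule: infinite_finite_induct)
  case (insert i A)
  then show ?case using trig_polys_add[of "p i" "\<lambda>x. \<Sum>i\<in>A. p i x"] by simp
qed (auto intro: trig_polys_zero)

text \<open>Multiplication by one exponential merely translates the frequency set by k. Products of
  trigonometric polynomials are sums of such terms, and k = 0 gives scalar multiples.\<close>

lemma trig_polys_cmult_expo:
  assumes "p \<in> trig_polys"
  shows "(\<lambda>x. c * expo k x * p x) \<in> trig_polys"
proof -
  obtain G d where G: "finite G" "p = (\<lambda>x. \<Sum>n\<in>G. d n * expo n x)"
    using assms by (rule trig_polysE)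
  have "c * expo k x * p x = (\<Sum>n\<in>(+) k ` G. c * d (n - k) * expo n x)" for x
    by (simp add: G(2) sum.reindex sum_distrib_left expo_add_index mult_ac)
  then show ?thesis using trig_polysI[of "(+) k ` G" "\<lambda>n. c * d (n - k)"] G(1) by simp
qed

lemma trig_polys_mult:
  assumes "p \<in> trig_polys" "q \<in> trig_polys"
  shows "(\<lambda>x. p x * q x) \<in> trig_polys"
proof -
  obtain F c where F: "finite F" "p = (\<lambda>x. \<Sum>n\<in>F. c n * expo n x)"
    using assms(1) by (rule trig_polysE)
  have "(\<lambda>x. \<Sum>n\<in>F. c n * expo n x * q x) \<in> trig_polys"
    by (intro trig_polys_sum trig_polys_cmult_expo assms)
  then show ?thesis by (simp add: F(2) sum_distrib_right)
qed

lemma trig_polys_cmult: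
  assumes "p \<in> trig_polys"
  shows "(\<lambda>x. c * p x) \<in> trig_polys"
  using trig_polys_cmult_expo[OF assms, of c 0] by simp

lemma trig_polys_const: "(\<lambda>x. c) \<in> trig_polys"
  using trig_polys_cmult[OF trig_polys_expo[of 0], of c] by simp

lemma trig_polys_L2: "p \<in> trig_polys \<Longrightarrow> p \<in> L2"
  by (auto simp: trig_polys_def intro!: L2_sum L2_cmult L2_expo)

text \<open>Induction on the formation of q. Sums, products and constants are closure properties; a
  real-linear q is a complex combination of z and its conjugate, which on the circle are
  \<open>expo 1\<close> and \<open>expo (- 1)\<close>.\<close>

lemma real_polynomial_function_expo:
  fixes q :: "complex \<Rightarrow> real"
  assumes "real_polynomial_function q"
  shows "(\<lambda>x. complex_of_real (q (expo 1 x))) \<in> trig_polys"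
  using assms
proof induction
  case (linear q)
  interpret q: bounded_linear q by fact
  have cnj: "cnj (expo 1 x) = expo (- 1) x" for x by (simp add: cnj_expo)
  \<comment> \<open>The map q is determined by q(1) and q(i); the coefficients come from Re z = (z +
    cnj z) / 2 and Im z = (z - cnj z) / (2 i).\<close>
  have "complex_of_real (q z) = (of_real (q 1) - \<i> * of_real (q \<i>)) / 2 * z
      + (of_real (q 1) + \<i> * of_real (q \<i>)) / 2 * cnj z" for z
  proof -
    have "q z = q (Re z *\<^sub>R 1 + Im z *\<^sub>R \<i>)"
      by (rule arg_cong[of _ _ q]) (simp add: complex_eq_iff)
    also have "\<dots> = Re z * q 1 + Im z * q \<i>"
      by (simp only: q.add q.scaleR real_scaleR_def)
    finally show ?thesis by (simp add: complex_eq_iff field_simps)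
  qed
  note this[of "expo 1 _", unfolded cnj]
  then show ?case
    by (simp only:) (intro trig_polys_add trig_polys_cmult trig_polys_expo)
next
  case (add f g)
  from trig_polys_add[OF add.IH] show ?case by simp
next
  case (mult f g)
  from trig_polys_mult[OF mult.IH] show ?case by simp
qed (rule trig_polys_const)

text \<open>A loop is a continuous function on the unit circle, where Stone--Weierstrass applies;
  a polynomial in $\Re z, \Im z$ restricted to the circle is a trigonometric polynomial.\<close>

lemma trig_polys_dense_uniform:
  fixes h :: "real \<Rightarrow> complex"
  assumes h: "continuous_on {0..1} h" "h 0 = h 1" and e: "e > 0"
  obtains p where "p \<in> trig_polys" "\<And>x. x \<in> {0..1} \<Longrightarrow> cmod (h x - p x) < e"
proof -
  let ?F = "h \<circ> (\<lambda>z. Arg2pi z / (2 * pi))"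
  \<comment> \<open>The trivial homotopy serves to obtain continuity of \<open>?F\<close> on the
    circle, including the point 1 where \<open>Arg2pi\<close> jumps; this is where h 0 = h 1
    enters.\<close>
  have "homotopic_loops UNIV h h"
    using h by (simp add: homotopic_loops_refl path_def pathfinish_def pathstart_def)
  then have "continuous_on (sphere 0 1) ?F"
    using homotopic_loops_imp_homotopic_circlemaps homotopic_with_imp_continuous by blast
  then obtain g :: "complex \<Rightarrow> complex" where g: "polynomial_function g"
      "\<And>z. z \<in> sphere 0 1 \<Longrightarrow> cmod (?F z - g z) < e"
    using Stone_Weierstrass_polynomial_function[of "sphere 0 1" ?F e] e by auto
  show thesis
  proof
    have r: "real_polynomial_function (Re \<circ> g)" "real_polynomial_function (Im \<circ> g)"
      using g(1) bounded_linear_Re bounded_linear_Im unfolding polynomial_function_def by blast+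
    have "(\<lambda>x. of_real ((Re \<circ> g) (expo 1 x)) + \<i> * of_real ((Im \<circ> g) (expo 1 x))) \<in> trig_polys"
      by (intro trig_polys_add trig_polys_cmult real_polynomial_function_expo r)
    then show "(\<lambda>x. g (expo 1 x)) \<in> trig_polys" by (simp flip: complex_eq)
    fix x :: real assume x: "x \<in> {0..1}"
    have "?F (expo 1 x) = h x"
    \<comment> \<open>At x = 1 the argument is 0 and not 2 pi, so \<open>?F\<close> returns h 0,
      which equals h 1.\<close>
    proof (cases "x = 1")
      case True
      then show ?thesis using expo_of_int[of 1 1] h Arg2pi_unique[of 1 0 1] by simp
    next
      case False
      then have "2 * pi * x < 2 * pi * 1" using x by (intro mult_strict_left_mono) auto
      then have "Arg2pi (expo 1 x) = 2 * pi * x"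
        using x by (intro Arg2pi_unique[of 1]) (auto simp: expo_def mult_ac)
      then show ?thesis by simp
    qed
    then show "cmod (h x - g (expo 1 x)) < e"
      using g(2)[of "expo 1 x"] by simp
  qed
qed


lemma cmod_sum3_square_le: "(cmod (u + v + w))\<^sup>2 \<le> 3 * ((cmod u)\<^sup>2 + (cmod v)\<^sup>2 + (cmod w)\<^sup>2)"
proof -
  have "cmod (u + v + w) \<le> cmod u + cmod v + cmod w"
    by (meson norm_triangle_ineq norm_triangle_mono order_refl)
  then have "(cmod (u + v + w))\<^sup>2 \<le> (cmod u + cmod v + cmod w)\<^sup>2"
    by (intro power_mono) auto
  also have "\<dots> \<le> 3 * ((cmod u)\<^sup>2 + (cmod v)\<^sup>2 + (cmod w)\<^sup>2)"
    using sum_squares_bound[of "cmod u" "cmod v"] sum_squares_bound[of "cmod u" "cmod w"]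
      sum_squares_bound[of "cmod v" "cmod w"]
    by (simp add: power2_eq_square algebra_simps)
  finally show ?thesis .
qed

text \<open>Approximate $f$ by a truncation, the truncation by a continuous function that vanishes at
  the endpoints (and so is a loop), and that function by a trigonometric polynomial.\<close>

lemma trig_polys_dense_L2:
  assumes f: "f \<in> L2" and e: "e > 0"
  obtains p where "p \<in> trig_polys" "L2_norm (\<lambda>x. f x - p x) < e"
proof -
  \<comment> \<open>Three squared errors of at most \<delta> each, with the factor 3 of
    \<open>cmod_sum3_square_le\<close>, add up to 9 \<delta> = e^2.\<close>
  define \<delta> where "\<delta> = e\<^sup>2 / 9"
  have \<delta>: "\<delta> > 0" using e by (simp add: \<delta>_def)
  have fm: "f \<in> borel_measurable unit_measure" using f by (rule L2_measurable)
  \<comment> \<open>Truncation is the nearest-point projection onto a disc: continuous because the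
    disc is convex, bounded by r, and moving z by at most |z| because 0 lies in the disc.\<close>
  define clip :: "nat \<Rightarrow> complex \<Rightarrow> complex" where "clip r = closest_point (cball 0 (real r))" for r
  have clip_cont: "continuous_on A (clip r)" for A r
    unfolding clip_def by (rule continuous_on_closest_point) auto
  have clip_le: "cmod (clip r z) \<le> real r" for r z
    using closest_point_in_set[of "cball 0 (real r)" z] by (simp add: clip_def)
  have clip_dist: "cmod (z - clip r z) \<le> cmod z" for r z
    using closest_point_le[of "cball 0 (real r)" 0 z] by (simp add: clip_def dist_norm)
  have clip_eq: "clip r z = z" if "cmod z \<le> real r" for r z
    using that by (simp add: clip_def closest_point_self)
  have clip_meas: "(\<lambda>x. clip r (u x)) \<in> borel_measurable unit_measure"
    if "u \<in> borel_measurable unit_measure" for r u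
    using measurable_compose[OF that borel_measurable_continuous_onI[OF clip_cont]] .

  have "(\<lambda>r. LINT x|unit_measure. (cmod (f x - clip r (f x)))\<^sup>2) \<longlonglongrightarrow> (LINT x|unit_measure. 0)"
  proof (rule integral_dominated_convergence)
    show "integrable unit_measure (\<lambda>x. (cmod (f x))\<^sup>2)" using f by (rule L2_integrable)
    show "AE x in unit_measure. (\<lambda>r. (cmod (f x - clip r (f x)))\<^sup>2) \<longlonglongrightarrow> 0"
    proof (rule AE_I2)
      fix x
      obtain r0 where "cmod (f x) \<le> real r0" using real_arch_simple by blast
      then have "(cmod (f x - clip r (f x)))\<^sup>2 = 0" if "r \<ge> r0" for r
        using that clip_eq[of "f x" r] by simp
      then show "(\<lambda>r. (cmod (f x - clip r (f x)))\<^sup>2) \<longlonglongrightarrow> 0"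
        by (intro tendsto_eventually eventually_sequentiallyI[of r0])
    qed
    show "AE x in unit_measure. norm ((cmod (f x - clip r (f x)))\<^sup>2) \<le> (cmod (f x))\<^sup>2" for r
      by (rule AE_I2) (simp add: power_mono clip_dist)
    show "(\<lambda>x. (cmod (f x - clip r (f x)))\<^sup>2) \<in> borel_measurable unit_measure" for r
      using fm clip_meas[OF fm] by simp
  qed simp
  then have "eventually (\<lambda>r. (LINT x|unit_measure. (cmod (f x - clip r (f x)))\<^sup>2) < \<delta>) sequentially"
    using \<delta> by (auto intro: order_tendstoD)
  then obtain r where r: "(LINT x|unit_measure. (cmod (f x - clip r (f x)))\<^sup>2) < \<delta>"
    by (auto simp: eventually_sequentially)

  \<comment> \<open>A Lebesgue measurable function is an almost everywhere limit of continuous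
    functions \<open>g n\<close>.\<close>
  have "f measurable_on UNIV"
    using f lebesgue_measurable_imp_measurable_on[of f UNIV] by (simp add: L2_def)
  then obtain N g where N: "negligible N" and g: "\<And>n::nat. continuous_on UNIV (g n)"
    and lim: "\<And>x. x \<notin> N \<Longrightarrow> (\<lambda>n. g n x) \<longlonglongrightarrow> f x"
    by (auto simp: measurable_on_def)
  \<comment> \<open>The cutoff vanishes at 0 and 1 and equals 1 where both x and 1 - x are at least
    1 / n. It makes \<open>h n\<close> a loop, while clipping \<open>g n\<close> gives the bound r,
    uniform in n, for dominated convergence.\<close>
  define cut :: "nat \<Rightarrow> real \<Rightarrow> real" where "cut n x = min 1 (real n * min x (1 - x))" for n x
  define h where "h n x = of_real (cut n x) * clip r (g n x)" for n x
  have h_cont: "continuous_on A (h n)" for A n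
    unfolding h_def cut_def
    by (intro continuous_intros continuous_on_compose2[OF clip_cont[of UNIV]] continuous_on_subset[OF g]) auto
  have h_meas: "h n \<in> borel_measurable unit_measure" for n
    by (intro continuous_imp_measurable_on_sets_lebesgue h_cont) auto
  have h_le: "cmod (h n x) \<le> real r" if "x \<in> {0..1}" for n x
  proof -
    have "0 \<le> cut n x" "cut n x \<le> 1" using that by (auto simp: cut_def)
    then have "cmod (h n x) \<le> 1 * real r"
      unfolding h_def norm_mult by (intro mult_mono clip_le) auto
    then show ?thesis by simp
  qed
  have diff_le: "cmod (clip r (f x) - h n x) \<le> 2 * real r" if "x \<in> {0..1}" for n x
    using norm_triangle_ineq4[of "clip r (f x)" "h n x"] clip_le[of r "f x"] h_le[OF that, of n] by simp
  have diff_le2: "(cmod (clip r (f x) - h n x))\<^sup>2 \<le> (2 * real r)\<^sup>2" if "x \<in> {0..1}" for n x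
    using diff_le[OF that] by (intro power_mono) auto
  have diff_meas: "(\<lambda>x. (cmod (clip r (f x) - h n x))\<^sup>2) \<in> borel_measurable unit_measure" for n
    using clip_meas[OF fm] h_meas by simp
  have "(\<lambda>n. LINT x|unit_measure. (cmod (clip r (f x) - h n x))\<^sup>2) \<longlonglongrightarrow> (LINT x|unit_measure. 0)"
  proof (rule integral_dominated_convergence)
    show "integrable unit_measure (\<lambda>x. (2 * real r)\<^sup>2)" by simp
    \<comment> \<open>The endpoints are discarded along with N, since the cutoff is 0 there for
      every n.\<close>
    have "AE x in lebesgue. x \<notin> N \<union> {0, 1}"
      using N by (intro AE_not_in) (simp add: negligible_iff_null_sets[symmetric])
    then have "AE x in unit_measure. x \<notin> N \<union> {0, 1} \<and> x \<in> {0..1}"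
      by (auto simp: AE_restrict_space_iff elim: eventually_mono)
    then show "AE x in unit_measure. (\<lambda>n. (cmod (clip r (f x) - h n x))\<^sup>2) \<longlonglongrightarrow> 0"
    proof eventually_elim
      case (elim x)
      then have m: "0 < min x (1 - x)" by auto
      obtain n0 where "1 / min x (1 - x) \<le> real n0" using real_arch_simple by blast
      then have "1 \<le> real n0 * min x (1 - x)" using m by (simp only: pos_divide_le_eq)
      moreover have "real n0 * min x (1 - x) \<le> real n * min x (1 - x)" if "n \<ge> n0" for n
        using that m by (intro mult_right_mono) auto
      ultimately have "cut n x = 1" if "n \<ge> n0" for n
        unfolding cut_def using that by (meson min_absorb1 order_trans)
      then have "(\<lambda>n. cut n x) \<longlonglongrightarrow> 1"
        by (intro tendsto_eventually eventually_sequentiallyI[of n0])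
      moreover have "(\<lambda>n. clip r (g n x)) \<longlonglongrightarrow> clip r (f x)"
        using clip_cont[of UNIV r] lim[of x] elim
        by (intro continuous_on_tendsto_compose[of UNIV "clip r"]) auto
      ultimately have "(\<lambda>n. h n x) \<longlonglongrightarrow> of_real 1 * clip r (f x)"
        unfolding h_def by (intro tendsto_mult tendsto_of_real)
      then have "(\<lambda>n. (cmod (clip r (f x) - h n x))\<^sup>2) \<longlonglongrightarrow> (cmod (clip r (f x) - of_real 1 * clip r (f x)))\<^sup>2"
        by (intro tendsto_intros)
      then show ?case by simp
    qed
    show "AE x in unit_measure. norm ((cmod (clip r (f x) - h n x))\<^sup>2) \<le> (2 * real r)\<^sup>2" for n
      by (rule AE_I2) (use diff_le2 in simp)
  qed (use diff_meas in simp_all)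
  then have "eventually (\<lambda>n. (LINT x|unit_measure. (cmod (clip r (f x) - h n x))\<^sup>2) < \<delta>) sequentially"
    using \<delta> by (auto intro: order_tendstoD)
  then obtain n where n: "(LINT x|unit_measure. (cmod (clip r (f x) - h n x))\<^sup>2) < \<delta>"
    by (auto simp: eventually_sequentially)

  have "h n 0 = h n 1" by (simp add: h_def cut_def)
  from trig_polys_dense_uniform[OF h_cont this, of "sqrt \<delta>"]
  obtain p where p: "p \<in> trig_polys" "\<And>x. x \<in> {0..1} \<Longrightarrow> cmod (h n x - p x) < sqrt \<delta>"
    using \<delta> by auto
  have p_le: "(cmod (h n x - p x))\<^sup>2 \<le> \<delta>" if "x \<in> {0..1}" for x
    using power_mono[OF less_imp_le[OF p(2)[OF that]], of 2] \<delta> by simp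
  have p_meas: "p \<in> borel_measurable unit_measure"
    using p(1) by (intro L2_measurable trig_polys_L2)

  have i1: "integrable unit_measure (\<lambda>x. (cmod (f x - clip r (f x)))\<^sup>2)"
    using L2_integrable[OF f] by (rule Bochner_Integration.integrable_bound)
      (use fm clip_meas[OF fm] in \<open>auto simp: power_mono clip_dist\<close>)
  have i2: "integrable unit_measure (\<lambda>x. (cmod (clip r (f x) - h n x))\<^sup>2)"
    by (rule Bochner_Integration.integrable_bound[where f = "\<lambda>x. (2 * real r)\<^sup>2"])
      (use diff_meas diff_le2 in \<open>auto intro!: AE_I2\<close>)
  have i3: "integrable unit_measure (\<lambda>x. (cmod (h n x - p x))\<^sup>2)"
    by (rule Bochner_Integration.integrable_bound[where f = "\<lambda>x. \<delta>"])
      (use h_meas p_meas p_le \<delta> in \<open>auto intro!: AE_I2\<close>)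
  \<comment> \<open>The interval has total mass 1, so the uniform error bound sqrt \<delta> bounds
    the mean square error by \<delta>.\<close>
  have "(LINT x|unit_measure. (cmod (h n x - p x))\<^sup>2) \<le> (LINT x|unit_measure. \<delta>)"
    by (rule integral_mono[OF i3]) (use p_le in auto)
  then have 3: "(LINT x|unit_measure. (cmod (h n x - p x))\<^sup>2) \<le> \<delta>"
    by (simp add: measure_restrict_space)
  have fp: "(\<lambda>x. f x - p x) \<in> L2" using L2_diff[OF f trig_polys_L2[OF p(1)]] .
  have "(L2_norm (\<lambda>x. f x - p x))\<^sup>2 \<le> (LINT x|unit_measure. 3 * ((cmod (f x - clip r (f x)))\<^sup>2
      + (cmod (clip r (f x) - h n x))\<^sup>2 + (cmod (h n x - p x))\<^sup>2))"
    unfolding L2_norm_square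
  proof (rule integral_mono[OF L2_integrable[OF fp]])
    show "integrable unit_measure (\<lambda>x. 3 * ((cmod (f x - clip r (f x)))\<^sup>2
      + (cmod (clip r (f x) - h n x))\<^sup>2 + (cmod (h n x - p x))\<^sup>2))"
      by (intro integrable_mult_right Bochner_Integration.integrable_add i1 i2 i3)
    show "(cmod (f x - p x))\<^sup>2 \<le> 3 * ((cmod (f x - clip r (f x)))\<^sup>2
      + (cmod (clip r (f x) - h n x))\<^sup>2 + (cmod (h n x - p x))\<^sup>2)" for x
      using cmod_sum3_square_le[of "f x - clip r (f x)" "clip r (f x) - h n x" "h n x - p x"] by simp
  qed
  also have "\<dots> = 3 * ((LINT x|unit_measure. (cmod (f x - clip r (f x)))\<^sup>2)
      + (LINT x|unit_measure. (cmod (clip r (f x) - h n x))\<^sup>2)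
      + (LINT x|unit_measure. (cmod (h n x - p x))\<^sup>2))"
    using i1 i2 i3 by simp
  also have "\<dots> < 9 * \<delta>" using r n 3 by simp
  also have "\<dots> = e\<^sup>2" by (simp add: \<delta>_def)
  finally have "L2_norm (\<lambda>x. f x - p x) < e" by (rule power2_less_imp_less) (use e in simp)
  with p(1) show thesis by (rule that)
qed

section \<open>Parseval families and their kernels\<close>

lemma sum_sesquilinear:
  fixes c :: "'a \<Rightarrow> complex"
  shows "(\<Sum>n\<in>F. c n * u n) * cnj (\<Sum>n\<in>F. c n * v n) = (\<Sum>n\<in>F. \<Sum>n'\<in>F. c n * cnj (c n') * (u n * cnj (v n')))"
  by (simp add: sum_product cnj_sum mult_ac)

lemma L2_inner_trig_poly:
  assumes "g \<in> L2"
  shows "L2_inner (\<lambda>x. \<Sum>n\<in>F. c n * expo n x) g = (\<Sum>n\<in>F. c n * L2_inner (expo n) g)"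
  using assms by (subst L2_inner_sum_left) (auto intro: L2_cmult L2_expo simp: L2_inner_cmult_left)

lemma L2_norm_trig_poly:
  fixes c :: "int \<Rightarrow> complex"
  shows "of_real ((L2_norm (\<lambda>x. \<Sum>n\<in>F. c n * expo n x))\<^sup>2)
    = (\<Sum>n\<in>F. \<Sum>n'\<in>F. c n * cnj (c n') * (if n = n' then 1 else 0))"
proof -
  let ?p = "\<lambda>x. \<Sum>n\<in>F. c n * expo n x"
  have p: "?p \<in> L2" by (intro L2_sum L2_cmult L2_expo)
  have "L2_inner (expo n) ?p = (\<Sum>n'\<in>F. cnj (c n') * (if n = n' then 1 else 0))" for n
  proof -
    have "L2_inner (expo n) ?p = cnj (L2_inner ?p (expo n))" by (simp add: L2_inner_cnj)
    also have "\<dots> = cnj (\<Sum>n'\<in>F. c n' * L2_inner (expo n') (expo n))"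
      by (simp only: L2_inner_trig_poly[OF L2_expo])
    also have "\<dots> = (\<Sum>n'\<in>F. cnj (c n') * (if n = n' then 1 else 0))"
      unfolding cnj_sum by (intro sum.cong) (auto simp: L2_inner_expo)
    finally show ?thesis .
  qed
  then show ?thesis
    unfolding L2_inner_self[symmetric] L2_inner_trig_poly[OF p]
    by (simp add: sum_distrib_left mult.assoc)
qed

text \<open>The abstract index i will stand for a pair (m, k); a layer j is any finite
  family.\<close>

definition frame_energy :: "(nat \<Rightarrow> 'i set) \<Rightarrow> (nat \<Rightarrow> 'i \<Rightarrow> real \<Rightarrow> complex) \<Rightarrow> nat \<Rightarrow> (real \<Rightarrow> complex) \<Rightarrow> real" where
  "frame_energy I g j f = (\<Sum>i\<in>I j. (cmod (L2_inner f (g j i)))\<^sup>2)"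

text \<open>The matrix of the frame operator of layer j with respect to the exponentials.\<close>

definition frame_kernel :: "(nat \<Rightarrow> 'i set) \<Rightarrow> (nat \<Rightarrow> 'i \<Rightarrow> real \<Rightarrow> complex) \<Rightarrow> nat \<Rightarrow> int \<Rightarrow> int \<Rightarrow> complex" where
  "frame_kernel I g j n n' = (\<Sum>i\<in>I j. L2_inner (expo n) (g j i) * cnj (L2_inner (expo n') (g j i)))"

text \<open>Taking the square root of the partial energy turns it into a seminorm in f, so that
  Minkowski's inequality is available through \<open>L2_set\<close>.\<close>

definition frame_partial_norm :: "(nat \<Rightarrow> 'i set) \<Rightarrow> (nat \<Rightarrow> 'i \<Rightarrow> real \<Rightarrow> complex) \<Rightarrow> nat \<Rightarrow> (real \<Rightarrow> complex) \<Rightarrow> real" where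
  "frame_partial_norm I g J f = L2_set (\<lambda>(j, i). cmod (L2_inner f (g j i))) (SIGMA j:{..<J}. I j)"

context
  fixes I :: "nat \<Rightarrow> 'i set" and g :: "nat \<Rightarrow> 'i \<Rightarrow> real \<Rightarrow> complex"
  assumes fin: "\<And>j. finite (I j)" and g: "\<And>j i. i \<in> I j \<Longrightarrow> g j i \<in> L2"
begin

lemma frame_energy_trig_poly:
  fixes c :: "int \<Rightarrow> complex"
  shows "of_real (frame_energy I g j (\<lambda>x. \<Sum>n\<in>F. c n * expo n x))
    = (\<Sum>n\<in>F. \<Sum>n'\<in>F. c n * cnj (c n') * frame_kernel I g j n n')"
proof -
  let ?p = "\<lambda>x. \<Sum>n\<in>F. c n * expo n x"
  have "complex_of_real (frame_energy I g j ?p) = (\<Sum>i\<in>I j. L2_inner ?p (g j i) * cnj (L2_inner ?p (g j i)))"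
    by (simp add: frame_energy_def complex_norm_square del: of_real_power)
  also have "\<dots> = (\<Sum>i\<in>I j. \<Sum>n\<in>F. \<Sum>n'\<in>F. c n * cnj (c n')
      * (L2_inner (expo n) (g j i) * cnj (L2_inner (expo n') (g j i))))"
    by (intro sum.cong refl) (simp only: L2_inner_trig_poly[OF g] sum_sesquilinear)
  also have "\<dots> = (\<Sum>n\<in>F. \<Sum>i\<in>I j. \<Sum>n'\<in>F. c n * cnj (c n')
      * (L2_inner (expo n) (g j i) * cnj (L2_inner (expo n') (g j i))))"
    by (rule sum.swap)
  also have "\<dots> = (\<Sum>n\<in>F. \<Sum>n'\<in>F. \<Sum>i\<in>I j. c n * cnj (c n')
      * (L2_inner (expo n) (g j i) * cnj (L2_inner (expo n') (g j i))))"
    by (intro sum.cong refl) (rule sum.swap)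
  finally show ?thesis by (simp add: frame_kernel_def sum_distrib_left)
qed

lemma frame_partial_norm_square: "(frame_partial_norm I g J f)\<^sup>2 = (\<Sum>j<J. frame_energy I g j f)"
proof -
  have "(frame_partial_norm I g J f)\<^sup>2 = (\<Sum>(j, i)\<in>(SIGMA j:{..<J}. I j). (cmod (L2_inner f (g j i)))\<^sup>2)"
    by (simp add: frame_partial_norm_def L2_set_def sum_nonneg case_prod_unfold)
  also have "\<dots> = (\<Sum>j<J. frame_energy I g j f)"
    unfolding frame_energy_def by (rule sum.Sigma[symmetric]) (auto simp: fin)
  finally show ?thesis .
qed

lemma frame_partial_norm_nonneg: "0 \<le> frame_partial_norm I g J f"
  by (simp add: frame_partial_norm_def)

lemma frame_partial_norm_triangle_diff:
  assumes "f \<in> L2" "h \<in> L2"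
  shows "frame_partial_norm I g J f \<le> frame_partial_norm I g J h + frame_partial_norm I g J (\<lambda>x. f x - h x)"
proof -
  have "frame_partial_norm I g J f \<le> L2_set (\<lambda>z. (case z of (j, i) \<Rightarrow> cmod (L2_inner h (g j i)))
      + (case z of (j, i) \<Rightarrow> cmod (L2_inner (\<lambda>x. f x - h x) (g j i)))) (SIGMA j:{..<J}. I j)"
    unfolding frame_partial_norm_def
  proof (rule L2_set_mono)
    fix z assume "z \<in> (SIGMA j:{..<J}. I j)"
    then obtain j i where z: "z = (j, i)" "i \<in> I j" by auto
    have "L2_inner f (g j i) = L2_inner h (g j i) + L2_inner (\<lambda>x. f x - h x) (g j i)"
      using L2_inner_diff_left[OF assms g[OF z(2)]] by simp
    then show "(case z of (j, i) \<Rightarrow> cmod (L2_inner f (g j i)))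
        \<le> (case z of (j, i) \<Rightarrow> cmod (L2_inner h (g j i)))
        + (case z of (j, i) \<Rightarrow> cmod (L2_inner (\<lambda>x. f x - h x) (g j i)))"
      using norm_triangle_ineq z(1) by simp
  qed auto
  also have "\<dots> \<le> frame_partial_norm I g J h + frame_partial_norm I g J (\<lambda>x. f x - h x)"
    unfolding frame_partial_norm_def by (rule L2_set_triangle_ineq)
  finally show ?thesis .
qed

text \<open>Cauchy-Schwarz for each of the finitely many generators. The constant depends on J,
  which suffices for approximation at fixed J.\<close>

lemma frame_partial_norm_bounded:
  obtains C where "C \<ge> 0" "\<And>f. f \<in> L2 \<Longrightarrow> frame_partial_norm I g J f \<le> C * L2_norm f"
proof
  let ?A = "SIGMA j:{..<J}. I j"
  let ?C = "L2_set (\<lambda>(j, i). L2_norm (g j i)) ?A"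
  show "?C \<ge> 0" by simp
  fix f assume f: "f \<in> L2"
  have "frame_partial_norm I g J f \<le> L2_set (\<lambda>z. L2_norm f * (case z of (j, i) \<Rightarrow> L2_norm (g j i))) ?A"
    unfolding frame_partial_norm_def
    by (rule L2_set_mono) (auto intro: L2_Cauchy_Schwarz f g)
  also have "\<dots> = ?C * L2_norm f"
    by (simp add: L2_set_right_distrib L2_norm_nonneg mult.commute)
  finally show "frame_partial_norm I g J f \<le> ?C * L2_norm f" .
qed

text \<open>On trigonometric polynomials each partial sum is at most the full sum. Density and
  continuity at fixed J extend this Bessel bound to all of \<open>L2\<close>, with constant 1 for
  every J; that uniformity lets the limit in J pass to f.\<close>

lemma parseval_if_parseval_on_trig_polys:
  assumes trig: "\<And>p. p \<in> trig_polys \<Longrightarrow> (\<lambda>j. frame_energy I g j p) sums (L2_norm p)\<^sup>2"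
    and f: "f \<in> L2"
  shows "(\<lambda>j. frame_energy I g j f) sums (L2_norm f)\<^sup>2"
proof -
  have trig_le: "frame_partial_norm I g J p \<le> L2_norm p" if "p \<in> trig_polys" for J p
  proof (rule power2_le_imp_le)
    have "(\<Sum>j<J. frame_energy I g j p) \<le> (\<Sum>j. frame_energy I g j p)"
      using trig[OF that] by (intro sum_le_suminf) (auto simp: sums_iff frame_energy_def intro: sum_nonneg)
    then show "(frame_partial_norm I g J p)\<^sup>2 \<le> (L2_norm p)\<^sup>2"
      using trig[OF that] by (simp add: frame_partial_norm_square sums_iff)
  qed (rule L2_norm_nonneg)
  have trig_lim: "(\<lambda>J. frame_partial_norm I g J p) \<longlonglongrightarrow> L2_norm p" if "p \<in> trig_polys" for p
  proof -
    have "(\<lambda>J. sqrt ((frame_partial_norm I g J p)\<^sup>2)) \<longlonglongrightarrow> sqrt ((L2_norm p)\<^sup>2)"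
      using trig[OF that] unfolding frame_partial_norm_square sums_def by (rule tendsto_real_sqrt)
    then show ?thesis by (simp add: frame_partial_norm_nonneg L2_norm_nonneg)
  qed
  have le: "frame_partial_norm I g J u \<le> L2_norm u" if u: "u \<in> L2" for J u
  proof (rule field_le_epsilon)
    fix e :: real assume e: "e > 0"
    obtain C where C: "C \<ge> 0" "\<And>f. f \<in> L2 \<Longrightarrow> frame_partial_norm I g J f \<le> C * L2_norm f"
      by (rule frame_partial_norm_bounded[of J]) blast
    \<comment> \<open>The approximation error enters twice: with factor C through the partial norm
      and with factor 1 through the norm of p.\<close>
    have "e / (1 + C) > 0" using e C by simp
    from trig_polys_dense_L2[OF u this] obtain p
      where p: "p \<in> trig_polys" "L2_norm (\<lambda>x. u x - p x) < e / (1 + C)" by blast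
    have pL: "p \<in> L2" using p(1) by (rule trig_polys_L2)
    let ?d = "L2_norm (\<lambda>x. u x - p x)"
    have "frame_partial_norm I g J u \<le> frame_partial_norm I g J p + frame_partial_norm I g J (\<lambda>x. u x - p x)"
      by (rule frame_partial_norm_triangle_diff[OF u pL])
    moreover have "frame_partial_norm I g J (\<lambda>x. u x - p x) \<le> C * ?d"
      by (rule C(2)[OF L2_diff[OF u pL]])
    moreover have "L2_norm p \<le> L2_norm u + ?d"
      using L2_norm_triangle_diff[OF pL u] L2_norm_minus_commute[of p u] by simp
    moreover have "(1 + C) * ?d \<le> e" using p(2) C(1) by (simp add: field_simps)
    ultimately show "frame_partial_norm I g J u \<le> L2_norm u + e"
      using trig_le[OF p(1), of J] by (simp add: algebra_simps)
  qed
  \<comment> \<open>Each third of e pays for one of three differences: partial norms of f and p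
    (uniformly in J by \<open>le\<close>), convergence at p, and norms of p and f.\<close>
  have "(\<lambda>J. frame_partial_norm I g J f) \<longlonglongrightarrow> L2_norm f"
  proof (rule LIMSEQ_I)
    fix e :: real assume e: "e > 0"
    then have "e / 3 > 0" by simp
    from trig_polys_dense_L2[OF f this] obtain p
      where p: "p \<in> trig_polys" "L2_norm (\<lambda>x. f x - p x) < e / 3" by blast
    have pL: "p \<in> L2" using p(1) by (rule trig_polys_L2)
    obtain J0 where J0: "\<And>J. J \<ge> J0 \<Longrightarrow> norm (frame_partial_norm I g J p - L2_norm p) < e / 3"
      using LIMSEQ_D[OF trig_lim[OF p(1)], of "e / 3"] e by auto
    have "norm (frame_partial_norm I g J f - L2_norm f) < e" if "J \<ge> J0" for J
      using J0[OF that] p(2) L2_norm_triangle_diff[OF f pL] L2_norm_triangle_diff[OF pL f]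
        frame_partial_norm_triangle_diff[OF f pL, of J] frame_partial_norm_triangle_diff[OF pL f, of J]
        le[OF L2_diff[OF f pL], of J] le[OF L2_diff[OF pL f], of J]
        L2_norm_minus_commute[of p f]
      unfolding real_norm_def by linarith
    then show "\<exists>J0. \<forall>J\<ge>J0. norm (frame_partial_norm I g J f - L2_norm f) < e" by blast
  qed
  then have "(\<lambda>J. (frame_partial_norm I g J f)\<^sup>2) \<longlonglongrightarrow> (L2_norm f)\<^sup>2" by (rule tendsto_power)
  then show ?thesis by (simp add: frame_partial_norm_square sums_def)
qed

text \<open>From kernels to energies: expand the energy of a trigonometric polynomial as a finite
  sesquilinear form and use density. Conversely, test the frame identity on one exponential for the
  diagonal and on combinations of two for the rest.\<close>

lemma parseval_iff_kernel:
  "(\<forall>f\<in>L2. (\<lambda>j. frame_energy I g j f) sums (L2_norm f)\<^sup>2)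
    \<longleftrightarrow> (\<forall>n n'. (\<lambda>j. frame_kernel I g j n n') sums (if n = n' then 1 else 0))"
proof (intro iffI ballI allI)
  fix f assume K: "\<forall>n n'. (\<lambda>j. frame_kernel I g j n n') sums (if n = n' then 1 else 0)" and f: "f \<in> L2"
  show "(\<lambda>j. frame_energy I g j f) sums (L2_norm f)\<^sup>2"
  proof (rule parseval_if_parseval_on_trig_polys[OF _ f])
    fix p assume "p \<in> trig_polys"
    then obtain F c where "finite F" and p: "p = (\<lambda>x. \<Sum>n\<in>F. c n * expo n x)"
      by (rule trig_polysE)
    have "(\<lambda>j. complex_of_real (frame_energy I g j p)) sums of_real ((L2_norm p)\<^sup>2)"
      unfolding p frame_energy_trig_poly L2_norm_trig_poly using K by (intro sums_sum sums_mult) auto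
    then show "(\<lambda>j. frame_energy I g j p) sums (L2_norm p)\<^sup>2" by (simp only: sums_of_real_iff)
  qed
next
  fix n n' assume "\<forall>f\<in>L2. (\<lambda>j. frame_energy I g j f) sums (L2_norm f)\<^sup>2"
  then have trig: "(\<lambda>j. \<Sum>n\<in>F. \<Sum>n'\<in>F. c n * cnj (c n') * frame_kernel I g j n n') sums
      (\<Sum>n\<in>F. \<Sum>n'\<in>F. c n * cnj (c n') * (if n = n' then 1 else 0))" for F and c :: "int \<Rightarrow> complex"
    unfolding frame_energy_trig_poly[symmetric] L2_norm_trig_poly[symmetric] sums_of_real_iff
    by (auto intro!: L2_sum L2_cmult L2_expo)
  have diag: "(\<lambda>j. frame_kernel I g j n n) sums 1" for n
    using trig[of "\<lambda>_. 1" "{n}"] by simp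
  show "(\<lambda>j. frame_kernel I g j n n') sums (if n = n' then 1 else 0)"
  proof (cases "n = n'")
    case True
    then show ?thesis using diag by simp
  next
    case False
    \<comment> \<open>Test function \<open>expo n\<close> plus c times \<open>expo n'\<close>;
      subtracting the known diagonal series leaves the mixed terms.\<close>
    have off: "(\<lambda>j. cnj c * frame_kernel I g j n n' + c * frame_kernel I g j n' n) sums 0" for c
    proof -
      have "(\<lambda>j. frame_kernel I g j n n + cnj c * frame_kernel I g j n n' + (c * frame_kernel I g j n' n + c * cnj c * frame_kernel I g j n' n'))
          sums (1 + c * cnj c)"
        using trig[of "\<lambda>k. if k = n then 1 else c" "{n, n'}"] False by simp
      from sums_diff[OF this sums_add[OF diag[of n] sums_mult[OF diag[of n'], of "c * cnj c"]]]
      show ?thesis by (simp add: algebra_simps)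
    qed
    \<comment> \<open>Polarization: the case c = 1 plus \<i> times the case c = \<i> cancels the
      transposed kernel and doubles the wanted one.\<close>
    have "(\<lambda>j. (frame_kernel I g j n n' + frame_kernel I g j n' n + \<i> * (- \<i> * frame_kernel I g j n n' + \<i> * frame_kernel I g j n' n)) / 2) sums 0"
      using sums_divide[OF sums_add[OF off[of 1] sums_mult[OF off[of \<i>], of \<i>]], of 2] by simp
    then show ?thesis using False by (simp add: algebra_simps)
  qed
qed

end

section \<open>Wavelet kernels\<close>

text \<open>The shifts are 2^j consecutive integers; hiding the starting point prepares a geometric
  sum and treats j = 0 uniformly.\<close>

lemma shift_range_eq:
  obtains s :: int where "shift_range j = (\<lambda>k. s + int k) ` {..<2 ^ j}"
proof (cases j)
  case 0
  then show thesis by (intro that[of 0]) (auto simp: shift_range_def)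
next
  case (Suc i)
  show thesis
  proof (rule that[of "- (2 ^ i) + 1"], intro equalityI subsetI)
    fix x assume "x \<in> shift_range j"
    then have x: "- (2 ^ i) + 1 \<le> x" "x \<le> 2 ^ i" by (auto simp: shift_range_def Suc)
    then have "nat (x + 2 ^ i - 1) < 2 ^ j"
      by (simp add: Suc nat_less_iff)
    with x show "x \<in> (\<lambda>k. - (2 ^ i) + 1 + int k) ` {..<2 ^ j}"
      by (intro image_eqI[of _ _ "nat (x + 2 ^ i - 1)"]) auto
  next
    fix x assume "x \<in> (\<lambda>k. - (2 ^ i) + 1 + int k) ` {..<2 ^ j}"
    then obtain k :: nat where k: "k < 2 ^ j" "x = - (2 ^ i) + 1 + int k" by auto
    have "int k < 2 ^ j" using k(1) by (metis of_nat_less_iff of_nat_numeral of_nat_power)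
    with k(2) show "x \<in> shift_range j" by (simp add: shift_range_def Suc)
  qed
qed

lemma finite_shift_range: "finite (shift_range j)"
  by (simp add: shift_range_def)

section \<open>Character sums and periodic sequences\<close>

lemma expo_eq_1_iff: "expo d x = 1 \<longleftrightarrow> real_of_int d * x \<in> \<int>"
proof -
  have "expo d x = 1 \<longleftrightarrow> (\<exists>m::int. real_of_int d * x = of_int m)"
    by (simp add: expo_def exp_eq_1 algebra_simps)
  then show ?thesis by (auto simp: Ints_def)
qed

lemma expo_power: "expo d x ^ k = expo d (real k * x)"
  by (induction k) (simp_all add: expo_add ring_distribs)

text \<open>Orthogonality of characters modulo 2^j: up to a phase this is a geometric sum whose
  ratio \<open>?w\<close> is a 2^j-th root of unity, equal to 1 exactly if 2^j divides d.\<close>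

lemma sum_expo_shift_range:
  "(\<Sum>k\<in>shift_range j. expo d (of_int k / 2 ^ j)) = (if 2 ^ j dvd d then 2 ^ j else 0)"
proof -
  obtain s where s: "shift_range j = (\<lambda>k. s + int k) ` {..<2 ^ j}" by (rule shift_range_eq)
  let ?w = "expo d (1 / 2 ^ j)"
  have "(\<Sum>k\<in>shift_range j. expo d (of_int k / 2 ^ j))
      = (\<Sum>k<2 ^ j. expo d (of_int (s + int k) / 2 ^ j))"
    unfolding s by (subst sum.reindex) (auto simp: inj_on_def)
  also have "\<dots> = (\<Sum>k<2 ^ j. expo d (of_int s / 2 ^ j) * ?w ^ k)"
    by (intro sum.cong refl) (simp add: expo_power expo_add[symmetric] add_divide_distrib)
  also have "\<dots> = expo d (of_int s / 2 ^ j) * (\<Sum>k<2 ^ j. ?w ^ k)"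
    by (simp add: sum_distrib_left)
  also have "\<dots> = (if 2 ^ j dvd d then 2 ^ j else 0)"
  proof (cases "2 ^ j dvd d")
    case True
    then obtain m where "d = 2 ^ j * m" by (elim dvdE)
    then have "?w = 1" "expo d (of_int s / 2 ^ j) = 1" by (simp_all add: expo_eq_1_iff)
    then show ?thesis using True by simp
  next
    case False
    have "?w \<noteq> 1"
    proof
      assume "?w = 1"
      then obtain m :: int where "real_of_int d / 2 ^ j = of_int m"
        by (auto simp: expo_eq_1_iff Ints_def)
      then have "real_of_int d = of_int (2 ^ j * m)" by (simp add: field_simps)
      then have "d = 2 ^ j * m" by (simp only: of_int_eq_iff)
      with False show False by simp
    qed
    moreover have "?w ^ 2 ^ j = 1"
      using expo_of_int[of d 1] by (simp add: expo_power)
    ultimately show ?thesis using False by (simp add: geometric_sum)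
  qed
  finally show ?thesis .
qed

lemma periodic_seqs_cong:
  assumes "s \<in> periodic_seqs N" "int N dvd n' - n"
  shows "s n' = s n"
proof -
  obtain k where k: "n' - n = int N * k" using assms(2) by (elim dvdE)
  have "s (m + int N * k) = s m" for m
  proof (induction k rule: int_induct[where k = 0])
    case (step1 i)
    then show ?case
      using assms(1) by (auto simp: periodic_seqs_def ring_distribs simp flip: add.assoc)
  next
    case (step2 i)
    then show ?case
      using assms(1)[unfolded periodic_seqs_def, simplified, rule_format, of "m + int N * (i - 1)"]
      by (simp add: algebra_simps)
  qed simp
  from this[of n] show ?thesis using k by (simp only: diff_eq_eq add.commute[of n])
qed

text \<open>Both recursive clauses in one: at j = 0 the term with \<open>a 1\<close> is multiplied
  by \<open>theta\<close> at level 0, which is 0.\<close>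

lemma theta_Suc:
  "theta \<rho> a b (Suc j) n = (\<Sum>m=1..\<rho> j. of_real ((cmod (b (Suc j) m n))\<^sup>2))
    + theta \<rho> a b j n * of_real ((cmod (a (Suc j) n))\<^sup>2)"
  by (cases j) simp_all

section \<open>Telescoping kernels of a refinable system\<close>

locale refinable_system =
  fixes \<phi> :: "nat \<Rightarrow> real \<Rightarrow> complex"
    and \<psi> :: "nat \<Rightarrow> nat \<Rightarrow> real \<Rightarrow> complex"
    and a :: "nat \<Rightarrow> int \<Rightarrow> complex"
    and b :: "nat \<Rightarrow> nat \<Rightarrow> int \<Rightarrow> complex"
    and \<rho> :: "nat \<Rightarrow> nat"
  assumes a_periodic: "\<And>j. j \<ge> 1 \<Longrightarrow> a (j + 1) \<in> periodic_seqs (2 ^ (j + 1))"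
    and refinement: "\<And>j n. j \<ge> 1 \<Longrightarrow>
      fourier_coeff (\<phi> j) n = of_real (sqrt 2) * a (j + 1) n * fourier_coeff (\<phi> (j + 1)) n"
    and psi_L2: "\<And>j m. m \<in> {1..\<rho> j} \<Longrightarrow> \<psi> j m \<in> L2"
    and b_periodic: "\<And>j m. m \<in> {1..\<rho> j} \<Longrightarrow> b (j + 1) m \<in> periodic_seqs (2 ^ (j + 1))"
    and psi_def: "\<And>j m n. m \<in> {1..\<rho> j} \<Longrightarrow>
      fourier_coeff (\<psi> j m) n = of_real (sqrt 2) * b (j + 1) m n * fourier_coeff (\<phi> (j + 1)) n"
begin

abbreviation phi_hat :: "nat \<Rightarrow> int \<Rightarrow> complex" where
  "phi_hat j \<equiv> fourier_coeff (\<phi> j)"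

definition wavelet_kernel :: "nat \<Rightarrow> int \<Rightarrow> int \<Rightarrow> complex" where
  "wavelet_kernel = frame_kernel (\<lambda>j. {1..\<rho> j} \<times> shift_range j) (\<lambda>j (m, k). shift j k (\<psi> j m))"

text \<open>This is P_j: the kernel of the 2^j shifts of \<open>\<phi> j\<close>, weighted by
  \<open>theta\<close>. It vanishes at j = 0.\<close>

definition scaling_kernel :: "nat \<Rightarrow> int \<Rightarrow> int \<Rightarrow> complex" where
  "scaling_kernel j n n' =
    (if 2 ^ j dvd n' - n then 2 ^ j * theta \<rho> a b j n * cnj (phi_hat j n) * phi_hat j n' else 0)"

text \<open>The left-hand side of condition (ii).\<close>

definition cross_symbol :: "nat \<Rightarrow> int \<Rightarrow> complex" where
  "cross_symbol j n = theta \<rho> a b j n * cnj (a (j + 1) n) * a (j + 1) (n + 2 ^ j)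
    + (\<Sum>m=1..\<rho> j. cnj (b (j + 1) m n) * b (j + 1) m (n + 2 ^ j))"

text \<open>This is X_j; the two divisibility conditions say that n' - n is an odd multiple of
  2^j.\<close>

definition cross_term :: "nat \<Rightarrow> int \<Rightarrow> int \<Rightarrow> complex" where
  "cross_term j n n' = (if 2 ^ j dvd n' - n \<and> \<not> 2 ^ (j + 1) dvd n' - n
    then 2 ^ (j + 1) * cnj (phi_hat (j + 1) n) * phi_hat (j + 1) n' * cross_symbol j n else 0)"

lemma parseval_wavelet_frame_iff:
  "parseval_wavelet_frame \<rho> \<psi>
    \<longleftrightarrow> (\<forall>n n'. (\<lambda>j. wavelet_kernel j n n') sums (if n = n' then 1 else 0))"
proof -
  have "parseval_wavelet_frame \<rho> \<psi> \<longleftrightarrow> (\<forall>f\<in>L2. (\<lambda>j. frame_energy (\<lambda>j. {1..\<rho> j} \<times> shift_range j)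
      (\<lambda>j (m, k). shift j k (\<psi> j m)) j f) sums (L2_norm f)\<^sup>2)"
    by (simp add: parseval_wavelet_frame_def frame_energy_def sum.cartesian_product case_prod_unfold)
  also have "\<dots> \<longleftrightarrow> (\<forall>n n'. (\<lambda>j. wavelet_kernel j n n') sums (if n = n' then 1 else 0))"
    unfolding wavelet_kernel_def by (rule parseval_iff_kernel) (auto simp: L2_shift psi_L2 finite_shift_range)
  finally show ?thesis .
qed

text \<open>The k-th shift contributes the phase \<open>expo (n' - n)\<close> at k / 2^j, so the sum
  over k yields 2^j or 0. The remaining factor 2 comes from the two factors sqrt 2.\<close>

lemma wavelet_kernel_eq:
  "wavelet_kernel j n n' = (if 2 ^ j dvd n' - n
    then 2 ^ (j + 1) * cnj (phi_hat (j + 1) n) * phi_hat (j + 1) n'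
      * (\<Sum>m=1..\<rho> j. cnj (b (j + 1) m n) * b (j + 1) m n') else 0)"
proof -
  have "wavelet_kernel j n n' = (\<Sum>m=1..\<rho> j. \<Sum>k\<in>shift_range j.
      L2_inner (expo n) (shift j k (\<psi> j m)) * cnj (L2_inner (expo n') (shift j k (\<psi> j m))))"
    by (simp add: wavelet_kernel_def frame_kernel_def sum.cartesian_product case_prod_unfold)
  also have "\<dots> = (\<Sum>m=1..\<rho> j. \<Sum>k\<in>shift_range j.
      2 * (cnj (phi_hat (j + 1) n) * phi_hat (j + 1) n') * (cnj (b (j + 1) m n) * b (j + 1) m n')
        * expo (n' - n) (of_int k / 2 ^ j))"
  proof (intro sum.cong refl)
    fix m k assume m: "m \<in> {1..\<rho> j}"
    have sq: "complex_of_real (sqrt 2) * complex_of_real (sqrt 2) = 2"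
      by (simp flip: of_real_mult)
    show "L2_inner (expo n) (shift j k (\<psi> j m)) * cnj (L2_inner (expo n') (shift j k (\<psi> j m)))
      = 2 * (cnj (phi_hat (j + 1) n) * phi_hat (j + 1) n') * (cnj (b (j + 1) m n) * b (j + 1) m n')
        * expo (n' - n) (of_int k / 2 ^ j)"
      by (simp add: L2_inner_expo_shift[OF psi_L2[OF m]] psi_def[OF m] sq[symmetric]
          expo_mult_cnj[symmetric] mult_ac)
  qed
  also have "\<dots> = (\<Sum>m=1..\<rho> j. 2 * (cnj (phi_hat (j + 1) n) * phi_hat (j + 1) n')
      * (cnj (b (j + 1) m n) * b (j + 1) m n')) * (if 2 ^ j dvd n' - n then 2 ^ j else 0)"
    by (simp only: sum_distrib_left[symmetric] sum_expo_shift_range)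
      (simp only: sum_distrib_left sum_distrib_right)
  also have "(\<Sum>m=1..\<rho> j. 2 * (cnj (phi_hat (j + 1) n) * phi_hat (j + 1) n')
      * (cnj (b (j + 1) m n) * b (j + 1) m n'))
      = 2 * (cnj (phi_hat (j + 1) n) * phi_hat (j + 1) n')
      * (\<Sum>m=1..\<rho> j. cnj (b (j + 1) m n) * b (j + 1) m n')"
    by (rule sum_distrib_left[symmetric])
  finally show ?thesis by simp
qed

text \<open>The refinement equation at n and n' raises the level by one, the two factors sqrt 2
  turning 2^j into 2^(j+1). It starts at j = 1; at j = 0 both sides are 0.\<close>

lemma scaling_kernel_refine:
  assumes "2 ^ j dvd n' - n"
  shows "scaling_kernel j n n' = 2 ^ (j + 1) * cnj (phi_hat (j + 1) n) * phi_hat (j + 1) n'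
    * (theta \<rho> a b j n * cnj (a (j + 1) n) * a (j + 1) n')"
proof (cases "j = 0")
  case True
  then show ?thesis by (simp add: scaling_kernel_def)
next
  case False
  have sq: "complex_of_real (sqrt 2) * complex_of_real (sqrt 2) = 2"
    by (simp flip: of_real_mult)
  from False refinement[of j n] refinement[of j n'] assms show ?thesis
    by (simp add: scaling_kernel_def sq[symmetric] mult_ac)
qed

text \<open>If 2^j does not divide n' - n, all four terms vanish. Otherwise n' is congruent to n or
  to n + 2^j modulo 2^(j+1), and periodicity of the masks replaces n' accordingly: the first case
  reproduces the recursion for \<open>theta\<close>, the second gives
  \<open>cross_symbol\<close>.\<close>

lemma kernel_step:
  "wavelet_kernel j n n' + scaling_kernel j n n' = scaling_kernel (j + 1) n n' + cross_term j n n'"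
proof (cases "2 ^ j dvd n' - n")
  case False
  then have "\<not> 2 ^ (j + 1) dvd n' - n" by (meson dvd_trans le_imp_power_dvd le_add1)
  with False show ?thesis
    by (simp add: wavelet_kernel_eq scaling_kernel_def cross_term_def)
next
  case True
  let ?c = "2 ^ (j + 1) * cnj (phi_hat (j + 1) n) * phi_hat (j + 1) n'"
  have sum: "wavelet_kernel j n n' + scaling_kernel j n n' = ?c *
      (theta \<rho> a b j n * cnj (a (j + 1) n) * a (j + 1) n'
        + (\<Sum>m=1..\<rho> j. cnj (b (j + 1) m n) * b (j + 1) m n'))"
    using True by (simp add: wavelet_kernel_eq scaling_kernel_refine ring_distribs)
  have cong: "theta \<rho> a b j n * cnj (a (j + 1) n) * a (j + 1) n' = theta \<rho> a b j n * cnj (a (j + 1) n) * a (j + 1) k"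
      "(\<Sum>m=1..\<rho> j. cnj (b (j + 1) m n) * b (j + 1) m n') = (\<Sum>m=1..\<rho> j. cnj (b (j + 1) m n) * b (j + 1) m k)"
    if k: "2 ^ (j + 1) dvd n' - k" for k
  proof -
    have k': "int (2 ^ (j + 1)) dvd n' - k" using k by simp
    show "theta \<rho> a b j n * cnj (a (j + 1) n) * a (j + 1) n' = theta \<rho> a b j n * cnj (a (j + 1) n) * a (j + 1) k"
    \<comment> \<open>Periodicity is assumed for \<open>a (j + 1)\<close> only from j = 1 on; at j =
      0 the factor \<open>theta\<close> is 0.\<close>
    proof (cases "j = 0")
      case False
      then have "a (j + 1) n' = a (j + 1) k" by (intro periodic_seqs_cong[OF a_periodic k']) simp
      then show ?thesis by simp
    qed simp
    show "(\<Sum>m=1..\<rho> j. cnj (b (j + 1) m n) * b (j + 1) m n') = (\<Sum>m=1..\<rho> j. cnj (b (j + 1) m n) * b (j + 1) m k)"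
      by (intro sum.cong refl arg_cong2[of _ _ _ _ "(*)"] periodic_seqs_cong[OF b_periodic k'])
  qed
  show ?thesis
  proof (cases "2 ^ (j + 1) dvd n' - n")
    case dvd: True
    have "theta \<rho> a b j n * cnj (a (j + 1) n) * a (j + 1) n
        + (\<Sum>m=1..\<rho> j. cnj (b (j + 1) m n) * b (j + 1) m n) = theta \<rho> a b (j + 1) n"
      by (simp add: theta_Suc complex_norm_square mult_ac del: of_real_power)
    then show ?thesis
      unfolding sum cong[OF dvd] using dvd by (simp add: scaling_kernel_def cross_term_def mult_ac)
  next
    case ndvd: False
    obtain k where k: "n' - n = 2 ^ j * k" using True by (elim dvdE)
    \<comment> \<open>Since k - 1 is even, n' and n + 2^j agree modulo 2^(j+1).\<close>
    have "odd k" using ndvd k by auto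
    then have "2 ^ (j + 1) dvd 2 ^ j * (k - 1)" by (auto elim!: oddE)
    moreover have "n' - (n + 2 ^ j) = 2 ^ j * (k - 1)" using k by (simp add: algebra_simps)
    ultimately have dvd: "2 ^ (j + 1) dvd n' - (n + 2 ^ j)" by simp
    show ?thesis
      unfolding sum cong[OF dvd] using True ndvd
      by (simp add: scaling_kernel_def cross_term_def cross_symbol_def)
  qed
qed

lemma sum_wavelet_kernel:
  "(\<Sum>j<J. wavelet_kernel j n n') = scaling_kernel J n n' + (\<Sum>j<J. cross_term j n n')"
proof (induction J)
  case 0
  show ?case by (simp add: scaling_kernel_def)
next
  case (Suc J)
  have "(\<Sum>j<Suc J. wavelet_kernel j n n')
      = (wavelet_kernel J n n' + scaling_kernel J n n') + (\<Sum>j<J. cross_term j n n')"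
    using Suc by (simp add: algebra_simps)
  then show ?case by (simp only: kernel_step) simp
qed

text \<open>Every power of 2 divides n - n = 0, so all cross terms vanish and the partial sum is the
  scaling kernel itself.\<close>

lemma wavelet_kernel_sums_diagonal:
  "(\<lambda>j. wavelet_kernel j n n) sums 1 \<longleftrightarrow>
    (\<lambda>j. 2 ^ j * of_real ((cmod (phi_hat j n))\<^sup>2) * theta \<rho> a b j n) \<longlonglongrightarrow> 1"
proof -
  have "(\<Sum>j<J. wavelet_kernel j n n) = 2 ^ J * of_real ((cmod (phi_hat J n))\<^sup>2) * theta \<rho> a b J n" for J
    by (simp add: sum_wavelet_kernel scaling_kernel_def cross_term_def complex_norm_square mult_ac
        del: of_real_power)
  then show ?thesis by (simp add: sums_def)
qed

text \<open>Here v is the 2-adic valuation of n' - n. Beyond level v the scaling kernel vanishes and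
  \<open>cross_term\<close> is nonzero at most at j = v, so the partial sums are eventually constant
  and the series has the value \<open>?x\<close>.\<close>

lemma wavelet_kernel_sums_off_diagonal:
  assumes "n' = 2 ^ v * k + n" "odd k"
  shows "(\<lambda>j. wavelet_kernel j n n') sums 0 \<longleftrightarrow>
    phi_hat (v + 1) n = 0 \<or> phi_hat (v + 1) n' = 0 \<or> cross_symbol v n = 0"
proof -
  have dvd: "2 ^ j dvd n' - n \<longleftrightarrow> j \<le> v" for j
  proof
    assume "2 ^ j dvd n' - n"
    then have *: "2 ^ j dvd 2 ^ v * k" using assms(1) by simp
    show "j \<le> v"
    proof (rule ccontr)
      assume "\<not> j \<le> v"
      then have "(2::int) ^ (v + 1) dvd 2 ^ j" by (intro le_imp_power_dvd) simp
      with * have "2 ^ (v + 1) dvd 2 ^ v * k" by (rule dvd_trans[rotated])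
      with assms(2) show False by simp
    qed
  next
    assume "j \<le> v"
    then show "2 ^ j dvd n' - n" using assms(1) by (simp add: le_imp_power_dvd)
  qed
  let ?x = "2 ^ (v + 1) * cnj (phi_hat (v + 1) n) * phi_hat (v + 1) n' * cross_symbol v n"
  have x: "cross_term j n n' = (if j = v then ?x else 0)" for j
    unfolding cross_term_def dvd by auto
  have "(\<Sum>j<J. wavelet_kernel j n n') = ?x" if "J \<ge> v + 1" for J
    using that by (simp add: sum_wavelet_kernel scaling_kernel_def dvd x)
  then have "(\<lambda>J. \<Sum>j<J. wavelet_kernel j n n') \<longlonglongrightarrow> ?x"
    by (intro tendsto_eventually eventually_sequentiallyI[of "v + 1"])
  then have "(\<lambda>j. wavelet_kernel j n n') sums ?x" by (simp only: sums_def)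
  then have "(\<lambda>j. wavelet_kernel j n n') sums 0 \<longleftrightarrow> ?x = 0" by (metis sums_unique2)
  then show ?thesis by simp
qed

lemma parseval_characterization:
  "parseval_wavelet_frame \<rho> \<psi> \<longleftrightarrow>
    (\<forall>n. (\<lambda>j. 2 ^ j * of_real ((cmod (phi_hat j n))\<^sup>2) * theta \<rho> a b j n) \<longlonglongrightarrow> 1) \<and>
    (\<forall>n j k. odd k \<longrightarrow>
      \<not> (phi_hat (j + 1) n = 0 \<or> phi_hat (j + 1) (2 ^ j * k + n) = 0) \<longrightarrow> cross_symbol j n = 0)"
proof -
  have "(\<forall>n n'. (\<lambda>j. wavelet_kernel j n n') sums (if n = n' then 1 else 0)) \<longleftrightarrow>
      (\<forall>n. (\<lambda>j. wavelet_kernel j n n) sums 1) \<and>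
      (\<forall>n n'. n \<noteq> n' \<longrightarrow> (\<lambda>j. wavelet_kernel j n n') sums 0)"
    by (auto split: if_splits)
  \<comment> \<open>Distinct n and n' differ by a power of 2 times an odd integer, the exponent
    being the multiplicity of 2 in n' - n.\<close>
  also have "(\<forall>n n'. n \<noteq> n' \<longrightarrow> (\<lambda>j. wavelet_kernel j n n') sums 0) \<longleftrightarrow>
      (\<forall>n v k. odd k \<longrightarrow> (\<lambda>j. wavelet_kernel j n (2 ^ v * k + n)) sums 0)"
  proof (intro iffI allI impI)
    fix n v and k :: int
    assume *: "\<forall>n n'. n \<noteq> n' \<longrightarrow> (\<lambda>j. wavelet_kernel j n n') sums 0" and "odd k"
    then have "n \<noteq> 2 ^ v * k + n" by auto
    with * show "(\<lambda>j. wavelet_kernel j n (2 ^ v * k + n)) sums 0" by blast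
  next
    fix n n' :: int
    assume *: "\<forall>n v k. odd k \<longrightarrow> (\<lambda>j. wavelet_kernel j n (2 ^ v * k + n)) sums 0" and "n \<noteq> n'"
    then have "n' - n \<noteq> 0" "\<not> is_unit (2::int)" by auto
    then obtain k where k: "n' - n = 2 ^ multiplicity 2 (n' - n) * k" "odd k"
      by (rule multiplicity_decompose')
    then have "n' = 2 ^ multiplicity 2 (n' - n) * k + n" by simp
    with * k(2) show "(\<lambda>j. wavelet_kernel j n n') sums 0" by metis
  qed
  finally show ?thesis
    by (simp add: parseval_wavelet_frame_iff wavelet_kernel_sums_diagonal
        wavelet_kernel_sums_off_diagonal[OF refl]) blast
qed

end

theorem theorem2p2:
  fixes \<phi> :: "nat \<Rightarrow> real \<Rightarrow> complex"
    and \<psi> :: "nat \<Rightarrow> nat \<Rightarrow> real \<Rightarrow> complex"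
    and a :: "nat \<Rightarrow> int \<Rightarrow> complex"
    and b :: "nat \<Rightarrow> nat \<Rightarrow> int \<Rightarrow> complex"
    and \<rho> :: "nat \<Rightarrow> nat"
  assumes phi_L2: "\<And>j. j \<ge> 1 \<Longrightarrow> \<phi> j \<in> L2"
    and a_periodic: "\<And>j. j \<ge> 1 \<Longrightarrow> a (j + 1) \<in> periodic_seqs (2 ^ (j + 1))"
    and refinement: "\<And>j n. j \<ge> 1 \<Longrightarrow>
      fourier_coeff (\<phi> j) n = of_real (sqrt 2) * a (j + 1) n * fourier_coeff (\<phi> (j + 1)) n"
    and rho_pos: "\<And>j. \<rho> j \<ge> 1"
    and psi_L2: "\<And>j m. m \<in> {1..\<rho> j} \<Longrightarrow> \<psi> j m \<in> L2"
    and b_periodic: "\<And>j m. m \<in> {1..\<rho> j} \<Longrightarrow> b (j + 1) m \<in> periodic_seqs (2 ^ (j + 1))"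
    and psi_def: "\<And>j m n. m \<in> {1..\<rho> j} \<Longrightarrow>
      fourier_coeff (\<psi> j m) n = of_real (sqrt 2) * b (j + 1) m n * fourier_coeff (\<phi> (j + 1)) n"
  shows "parseval_wavelet_frame \<rho> \<psi> \<longleftrightarrow>
    (\<forall>n. (\<lambda>j. 2 ^ j * of_real ((cmod (fourier_coeff (\<phi> j) n))\<^sup>2) * theta \<rho> a b j n)
            \<longlonglongrightarrow> 1) \<and>
    (\<forall>n j k. odd k \<longrightarrow>
       \<not> (fourier_coeff (\<phi> (j + 1)) n = 0 \<or> fourier_coeff (\<phi> (j + 1)) (2 ^ j * k + n) = 0) \<longrightarrow>
       theta \<rho> a b j n * cnj (a (j + 1) n) * a (j + 1) (n + 2 ^ j)
         + (\<Sum>m=1..\<rho> j. cnj (b (j + 1) m n) * b (j + 1) m (n + 2 ^ j)) = 0)"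
proof -
  interpret refinable_system \<phi> \<psi> a b \<rho>
    using a_periodic refinement psi_L2 b_periodic psi_def by unfold_locales
  show ?thesis
    using parseval_characterization unfolding cross_symbol_def .
qed

end
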